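(* Let $\Omega$ be a slice domain in $\mathbb{H}$ and let $f,g:\Omega\to\mathbb{H}$ be slice regular functions. Fix $S=x+y\mathbb{S}$ ($x,y\in\mathbb{R}$) intersecting $\Omega$ and a connected component $C$ of the intersection $S\cap\Omega$. 1. $Z(f*g)$ is the union between $Z(f)$ and the set of points $p\in\Omega\setminus Z(f)$ such that $q-f(p)^{-1}pf(p)$ divides $g(q)$ near $p$. 2. $Z(f^s)$ intersects $C$ if, and only if, it includes $C$; this happens if, and only if, there exists $\widetilde p\in S$ such that $q-\widetilde p$ divides $f(q)$ near $C$. 3. There exists $\widetilde p\in S$ such that $q-\widetilde p$ divides $f(q)$ near $C$ if, and only if, there exists $\widehat p\in S$ such that $q-\widehat p$ divides $f^c(q)$ near $C$.
   Context: $\mathbb{H}$ is the real algebra of quaternions, $\mathbb{S}=\{J\in\mathbb{H}:J^2=-1\}$, $x+y\mathbb{S}=\{x+yJ:J\in\mathbb{S}\}$, $L_I=\mathbb{R}+I\mathbb{R}$ and $T_I=T\cap L_I$ for $I\in\mathbb{S}$, $T\subseteq\mathbb{H}$. For $q=x+yI$ ($x,y\in\mathbb{R}$, $I\in\mathbb{S}$), $\operatorname{Re}(q)=x$ and $\operatorname{Im}(q)=yI$. A domain is a nonempty open connected set; a slice domain is a domain $\Omega\subseteq\mathbb{H}$ with $\Omega\cap\mathbb{R}\neq\emptyset$ such that $\Omega_I$ is a domain of $L_I$ for every $I\in\mathbb{S}$. A function $f:\Omega\to\mathbb{H}$ is slice regular if, for every $I\in\mathbb{S}$, the restriction $f_I$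 of $f$ to $\Omega_I$ has continuous partial derivatives and $\frac12\left(\frac{\partial}{\partial x}+I\frac{\partial}{\partial y}\right)f_I(x+yI)\equiv0$. $Z(f)$ denotes the zero set of $f$ in $\Omega$. Spherical value and derivative: for a slice regular $f$ on a slice domain $\Omega$ and $p_0=x_0+y_0I_0\in\Omega\setminus\mathbb{R}$ ($y_0>0$, $I_0\in\mathbb{S}$), it is known that there exist a neighborhood $U\subseteq\Omega$ of $p_0$ in $x_0+y_0\mathbb{S}$ and unique quaternions $b(p_0),c(p_0)$ (independent of $U$) with $f(x_0+y_0I)=b(p_0)+I\,c(p_0)$ for all $x_0+y_0I\in U$. Set $f^\circ_s(p_0)=b(p_0)$ and $f'_s(p_0)=y_0^{-1}c(p_0)$; for $p_0\in\Omega\cap\mathbb{R}$ set $f^\circ_s(p_0)=f(p_0)$. Operations: for $q\in\Omega\setminus\mathbb{R}$, $(f*g)(q)=f^\circ_s(q)g^\circ_s(q)+\operatorname{Im}(q)^2f'_s(q)g'_s(q)+\operatorname{Im}(q)\big(f^\circ_s(q)g'_s(q)+f'_s(q)g^\circ_s(q)\big)$, $f^c(q)=\overline{f^\circ_s(q)}+\operatorname{Im}(q)\overline{f'_s(q)}$, $f^s(q)=|f^\circ_s(q)|^2-|\operatorname{Im}(q)f'_s(q)|^2+2\operatorname{Im}(q)\operatorname{Re}\big(f^\circ_s(q)\overline{f'_s(q)}\big)$; for $q\in\Omega\cap\mathbb{R}$, $(f*g)(q)=f(q)g(q)$, $f^c(q)=\overline{f(q)}$, $f^s(q)=|f(q)|^2$.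 The functions $f*g$, $f^c$, $f^s$ are slice regular on $\Omega$. Divisibility: let $C$ be a connected component of $(x+y\mathbb{S})\cap\Omega$ and let $\widetilde p\in x+y\mathbb{S}$ (possibly $\widetilde p\notin C$). One says that $q-\widetilde p$ divides $f(q)$ near $C$ if there exist a slice domain $\Lambda$ with $C\subseteq\Lambda\subseteq\Omega$ and a slice regular function $h:\Lambda\to\mathbb{H}$ such that $f(q)=(q-\widetilde p)*h(q)$ in $\Lambda$ (regular product of $q\mapsto q-\widetilde p$ and $h$). For $p\in(x+y\mathbb{S})\cap\Omega$, one says that $q-\widetilde p$ divides $f(q)$ near $p$ if it divides $f(q)$ near the connected component of $(x+y\mathbb{S})\cap\Omega$ that includes $p$. *)

theory Defs
  imports "HOL-Analysis.Analysis"
begin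

section \<open>The quaternions\<close>

text \<open>
  The coordinates of \<open>Quat a b c d\<close> are taken with respect to the standard basis
  \<open>1, i, j, k\<close>.
\<close>

datatype quat = Quat (qRe: real) (qI: real) (qJ: real) (qK: real)

lemma quat_eq_iff:
  "p = q \<longleftrightarrow> qRe p = qRe q \<and> qI p = qI q \<and> qJ p = qJ q \<and> qK p = qK q"
  by (cases p; cases q) simp

instantiation quat :: ab_group_add
begin

definition zero_quat :: quat where "0 = Quat 0 0 0 0"

definition plus_quat :: "quat \<Rightarrow> quat \<Rightarrow> quat" where
  "p + q = Quat (qRe p + qRe q) (qI p + qI q) (qJ p + qJ q) (qK p + qK q)"

definition uminus_quat :: "quat \<Rightarrow> quat" where
  "- p = Quat (- qRe p) (- qI p) (- qJ p) (- qK p)"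

definition minus_quat :: "quat \<Rightarrow> quat \<Rightarrow> quat" where
  "p - q = Quat (qRe p - qRe q) (qI p - qI q) (qJ p - qJ q) (qK p - qK q)"

instance
  by standard (simp_all add: quat_eq_iff zero_quat_def plus_quat_def uminus_quat_def minus_quat_def)

end

lemma quat_add_sel [simp]:
  "qRe (p + q) = qRe p + qRe q" "qI (p + q) = qI p + qI q"
  "qJ (p + q) = qJ p + qJ q" "qK (p + q) = qK p + qK q"
  "qRe (p - q) = qRe p - qRe q" "qI (p - q) = qI p - qI q"
  "qJ (p - q) = qJ p - qJ q" "qK (p - q) = qK p - qK q"
  "qRe (- p) = - qRe p" "qI (- p) = - qI p" "qJ (- p) = - qJ p" "qK (- p) = - qK p"
  "qRe 0 = 0" "qI 0 = 0" "qJ 0 = 0" "qK 0 = 0"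
  by (simp_all add: zero_quat_def plus_quat_def uminus_quat_def minus_quat_def)

instantiation quat :: real_algebra_1
begin

definition one_quat :: quat where "1 = Quat 1 0 0 0"

definition times_quat :: "quat \<Rightarrow> quat \<Rightarrow> quat" where
  "p * q = Quat
     (qRe p * qRe q - qI p * qI q - qJ p * qJ q - qK p * qK q)
     (qRe p * qI q + qI p * qRe q + qJ p * qK q - qK p * qJ q)
     (qRe p * qJ q - qI p * qK q + qJ p * qRe q + qK p * qI q)
     (qRe p * qK q + qI p * qJ q - qJ p * qI q + qK p * qRe q)"

definition scaleR_quat :: "real \<Rightarrow> quat \<Rightarrow> quat" where
  "scaleR r p = Quat (r * qRe p) (r * qI p) (r * qJ p) (r * qK p)"

instance
  by standard (simp_all add: quat_eq_iff one_quat_def times_quat_def scaleR_quat_def algebra_simps)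

end

lemma quat_mult_sel [simp]:
  "qRe (p * q) = qRe p * qRe q - qI p * qI q - qJ p * qJ q - qK p * qK q"
  "qI (p * q) = qRe p * qI q + qI p * qRe q + qJ p * qK q - qK p * qJ q"
  "qJ (p * q) = qRe p * qJ q - qI p * qK q + qJ p * qRe q + qK p * qI q"
  "qK (p * q) = qRe p * qK q + qI p * qJ q - qJ p * qI q + qK p * qRe q"
  "qRe 1 = 1" "qI 1 = 0" "qJ 1 = 0" "qK 1 = 0"
  "qRe (r *\<^sub>R p) = r * qRe p" "qI (r *\<^sub>R p) = r * qI p"
  "qJ (r *\<^sub>R p) = r * qJ p" "qK (r *\<^sub>R p) = r * qK p"
  by (simp_all add: one_quat_def times_quat_def scaleR_quat_def)

lemma quat_of_real_sel [simp]:
  "qRe (of_real r) = r" "qI (of_real r) = 0" "qJ (of_real r) = 0" "qK (of_real r) = 0"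
  by (simp_all add: of_real_def)

instantiation quat :: real_inner
begin

definition inner_quat :: "quat \<Rightarrow> quat \<Rightarrow> real" where
  "inner p q = qRe p * qRe q + qI p * qI q + qJ p * qJ q + qK p * qK q"

definition norm_quat_def: "norm p = sqrt (inner p p)" for p :: quat

definition sgn_quat_def: "sgn p = p /\<^sub>R norm p" for p :: quat

definition dist_quat_def: "dist p q = norm (p - q)" for p q :: quat

definition uniformity_quat_def:
  "(uniformity :: (quat \<times> quat) filter) =
     (INF e\<in>{0 <..}. principal {(p, q). dist p q < e})"

definition open_quat_def:
  "open (U :: quat set) \<longleftrightarrow>
     (\<forall>p\<in>U. eventually (\<lambda>(p', q). p' = p \<longrightarrow> q \<in> U) uniformity)"

instance
proof
  fix p q r :: quat and a :: real
  show "inner p q = inner q p"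
    by (simp add: inner_quat_def algebra_simps)
  show "inner (p + q) r = inner p r + inner q r"
    by (simp add: inner_quat_def algebra_simps)
  show "inner (a *\<^sub>R p) q = a * inner p q"
    by (simp add: inner_quat_def algebra_simps)
  show "0 \<le> inner p p"
    by (simp add: inner_quat_def)
  have "inner p p = (qRe p)\<^sup>2 + (qI p)\<^sup>2 + ((qJ p)\<^sup>2 + (qK p)\<^sup>2)"
    by (simp add: inner_quat_def power2_eq_square)
  then show "(inner p p = 0) = (p = 0)"
    by (simp add: quat_eq_iff add_nonneg_eq_0_iff)
qed (rule norm_quat_def sgn_quat_def dist_quat_def uniformity_quat_def open_quat_def)+

end

definition qcnj :: "quat \<Rightarrow> quat" where
  "qcnj p = Quat (qRe p) (- qI p) (- qJ p) (- qK p)"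

lemma qcnj_sel [simp]:
  "qRe (qcnj p) = qRe p" "qI (qcnj p) = - qI p" "qJ (qcnj p) = - qJ p" "qK (qcnj p) = - qK p"
  by (simp_all add: qcnj_def)

lemma quat_mult_qcnj: "p * qcnj p = of_real (inner p p)" "qcnj p * p = of_real (inner p p)"
  by (simp_all add: quat_eq_iff inner_quat_def algebra_simps)

instantiation quat :: real_normed_div_algebra
begin

definition inverse_quat :: "quat \<Rightarrow> quat" where
  "inverse p = qcnj p /\<^sub>R (norm p)\<^sup>2"

definition divide_quat_def: "p div q = p * inverse q" for p q :: quat

instance
proof
  fix p q :: quat
  show "p div q = p * inverse q"
    by (rule divide_quat_def)
  show "inverse (0 :: quat) = 0"
    by (simp add: inverse_quat_def)
  show "inverse p * p = 1" if "p \<noteq> 0"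
    using that
    by (simp add: inverse_quat_def power2_norm_eq_inner quat_mult_qcnj) (simp add: of_real_def)
  show "p * inverse p = 1" if "p \<noteq> 0"
    using that
    by (simp add: inverse_quat_def power2_norm_eq_inner quat_mult_qcnj) (simp add: of_real_def)
  show "norm (p * q) = norm p * norm q"
    unfolding norm_quat_def real_sqrt_mult [symmetric]
    by (rule arg_cong [where f = sqrt]) (simp add: inner_quat_def, algebra)
qed

end

instantiation quat :: euclidean_space
begin

definition Basis_quat :: "quat set" where
  "Basis = {Quat 1 0 0 0, Quat 0 1 0 0, Quat 0 0 1 0, Quat 0 0 0 1}"

instance
proof
  fix p u v :: quat
  show "(Basis :: quat set) \<noteq> {}" "finite (Basis :: quat set)"
    by (simp_all add: Basis_quat_def)
  show "inner u v = (if u = v then 1 else 0)" if "u \<in> Basis" "v \<in> Basis"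
    using that unfolding Basis_quat_def by (elim insertE emptyE) (simp_all add: inner_quat_def)
  show "(\<forall>u\<in>Basis. inner p u = 0) \<longleftrightarrow> p = 0"
    by (simp add: Basis_quat_def inner_quat_def quat_eq_iff [of p 0])
qed

end

definition qIm :: "quat \<Rightarrow> quat" where
  "qIm q = Quat 0 (qI q) (qJ q) (qK q)"


section \<open>Slice domains and slice regular functions\<close>

definition imag_units :: "quat set" where
  "imag_units = {J. J\<^sup>2 = -1}"

definition qsphere :: "real \<Rightarrow> real \<Rightarrow> quat set" where
  "qsphere x y = {of_real x + y *\<^sub>R J | J. J \<in> imag_units}"

definition slice_plane :: "quat \<Rightarrow> quat set" where
  "slice_plane I = {of_real x + y *\<^sub>R I | x y. True}"

definition domain_of :: "quat set \<Rightarrow> quat set \<Rightarrow> bool" where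
  "domain_of X T \<longleftrightarrow> T \<noteq> {} \<and> openin (top_of_set X) T \<and> connected T"

definition slice_domain :: "quat set \<Rightarrow> bool" where
  "slice_domain \<Omega> \<longleftrightarrow> domain_of UNIV \<Omega> \<and> \<Omega> \<inter> \<real> \<noteq> {} \<and>
     (\<forall>I\<in>imag_units. domain_of (slice_plane I) (\<Omega> \<inter> slice_plane I))"

text \<open>
  Functions on \<open>\<Omega>\<close> are represented by total functions whose values outside \<open>\<Omega>\<close> are
  irrelevant. Below, \<open>fx\<close> and \<open>fy\<close> are the partial derivatives of
  \<open>(x, y) \<mapsto> f (x + y I)\<close>. The derivatives are two-sided, which is adequate
  because \<open>\<Omega>\<close> is always open.
\<close>

definition slice_regular :: "quat set \<Rightarrow> (quat \<Rightarrow> quat) \<Rightarrow> bool" where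
  "slice_regular \<Omega> f \<longleftrightarrow>
     (\<forall>I\<in>imag_units. \<exists>fx fy :: real \<times> real \<Rightarrow> quat.
        let D = {(x, y). of_real x + y *\<^sub>R I \<in> \<Omega>} in
        continuous_on D fx \<and> continuous_on D fy \<and>
        (\<forall>(x, y)\<in>D.
           ((\<lambda>t. f (of_real t + y *\<^sub>R I)) has_vector_derivative fx (x, y)) (at x) \<and>
           ((\<lambda>t. f (of_real x + t *\<^sub>R I)) has_vector_derivative fy (x, y)) (at y) \<and>
           (1 / 2) *\<^sub>R (fx (x, y) + I * fy (x, y)) = 0))"

definition zero_set :: "quat set \<Rightarrow> (quat \<Rightarrow> quat) \<Rightarrow> quat set" where
  "zero_set \<Omega> f = {q \<in> \<Omega>. f q = 0}"


section \<open>Spherical value and spherical derivative\<close>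

definition has_spherical_coeffs ::
  "quat set \<Rightarrow> (quat \<Rightarrow> quat) \<Rightarrow> quat \<Rightarrow> quat \<Rightarrow> quat \<Rightarrow> bool" where
  "has_spherical_coeffs \<Omega> f p b c \<longleftrightarrow>
     (let x = qRe p; y = norm (qIm p) in
      \<exists>U. openin (top_of_set (qsphere x y)) U \<and> p \<in> U \<and> U \<subseteq> \<Omega> \<and>
          (\<forall>I\<in>imag_units. of_real x + y *\<^sub>R I \<in> U \<longrightarrow> f (of_real x + y *\<^sub>R I) = b + I * c))"

text \<open>
  For slice regular \<open>f\<close> on a slice domain \<open>\<Omega>\<close>, the pair \<open>(b, c)\<close> exists and is unique at
  every point of \<open>\<Omega> - \<real>\<close>; the definite description is meaningful only there.
\<close>

definition spherical_coeffs :: "quat set \<Rightarrow> (quat \<Rightarrow> quat) \<Rightarrow> quat \<Rightarrow> quat \<times> quat" where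
  "spherical_coeffs \<Omega> f p = (THE (b, c). has_spherical_coeffs \<Omega> f p b c)"

definition spherical_value :: "quat set \<Rightarrow> (quat \<Rightarrow> quat) \<Rightarrow> quat \<Rightarrow> quat" where
  "spherical_value \<Omega> f p = (if p \<in> \<real> then f p else fst (spherical_coeffs \<Omega> f p))"

text \<open>Not meaningful at real points, where no operation below uses it.\<close>

definition spherical_deriv :: "quat set \<Rightarrow> (quat \<Rightarrow> quat) \<Rightarrow> quat \<Rightarrow> quat" where
  "spherical_deriv \<Omega> f p = snd (spherical_coeffs \<Omega> f p) /\<^sub>R norm (qIm p)"


section \<open>Regular product, regular conjugate, symmetrization\<close>

definition regular_prod ::
  "quat set \<Rightarrow> (quat \<Rightarrow> quat) \<Rightarrow> (quat \<Rightarrow> quat) \<Rightarrow> quat \<Rightarrow> quat" where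
  "regular_prod \<Omega> f g q =
     (if q \<in> \<real> then f q * g q
      else spherical_value \<Omega> f q * spherical_value \<Omega> g q
         + (qIm q)\<^sup>2 * spherical_deriv \<Omega> f q * spherical_deriv \<Omega> g q
         + qIm q * (spherical_value \<Omega> f q * spherical_deriv \<Omega> g q
                  + spherical_deriv \<Omega> f q * spherical_value \<Omega> g q))"

definition regular_conj :: "quat set \<Rightarrow> (quat \<Rightarrow> quat) \<Rightarrow> quat \<Rightarrow> quat" where
  "regular_conj \<Omega> f q =
     (if q \<in> \<real> then qcnj (f q)
      else qcnj (spherical_value \<Omega> f q) + qIm q * qcnj (spherical_deriv \<Omega> f q))"

definition symmetrization :: "quat set \<Rightarrow> (quat \<Rightarrow> quat) \<Rightarrow> quat \<Rightarrow> quat" where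
  "symmetrization \<Omega> f q =
     (if q \<in> \<real> then of_real ((norm (f q))\<^sup>2)
      else of_real ((norm (spherical_value \<Omega> f q))\<^sup>2)
         - of_real ((norm (qIm q * spherical_deriv \<Omega> f q))\<^sup>2)
         + 2 * qIm q * of_real (qRe (spherical_value \<Omega> f q * qcnj (spherical_deriv \<Omega> f q))))"


section \<open>Divisibility by a linear factor\<close>

text \<open>
  \<open>divides_near \<Omega> p' f C\<close> says that \<open>q - p'\<close> divides \<open>f(q)\<close> near \<open>C\<close>; it is meant for a connected
  component \<open>C\<close> of \<open>qsphere x y \<inter> \<Omega>\<close> and for \<open>p' \<in> qsphere x y\<close>.
\<close>

definition divides_near :: "quat set \<Rightarrow> quat \<Rightarrow> (quat \<Rightarrow> quat) \<Rightarrow> quat set \<Rightarrow> bool" where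
  "divides_near \<Omega> p' f C \<longleftrightarrow>
     (\<exists>\<Lambda> h. slice_domain \<Lambda> \<and> C \<subseteq> \<Lambda> \<and> \<Lambda> \<subseteq> \<Omega> \<and> slice_regular \<Lambda> h \<and>
        (\<forall>q\<in>\<Lambda>. f q = regular_prod \<Lambda> (\<lambda>q. q - p') h q))"

text \<open>The sphere \<open>x + y \<S>\<close> through \<open>p\<close> is \<open>qsphere (qRe p) (norm (qIm p))\<close>.\<close>

definition divides_near_point :: "quat set \<Rightarrow> quat \<Rightarrow> (quat \<Rightarrow> quat) \<Rightarrow> quat \<Rightarrow> bool" where
  "divides_near_point \<Omega> p' f p \<longleftrightarrow>
     divides_near \<Omega> p' f
       (connected_component_set (qsphere (qRe p) (norm (qIm p)) \<inter> \<Omega>) p)"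

end

theory Submission
  imports Defs "HOL-Complex_Analysis.Conformal_Mappings"
begin

text \<open>
  Write a point of the sphere \<open>x + y\<S>\<close>, \<open>y \<ge> 0\<close>, as \<open>x + y J\<close>. Everything is read off from the
  coefficients \<open>b, c\<close> of the local representation \<open>f (x + y J) = b + J c\<close>, which are constant on a
  component \<open>C\<close> of the part of the sphere in \<open>\<Omega>\<close> (\<open>sphere_pair_constant\<close>).

  The local representation (\<open>local_stem\<close>) holds because a path from the given point to the real axis
  in its slice can be moved to all neighbouring slices. Two of them determine \<open>b\<close> and \<open>c\<close> along the
  path; on every other one, \<open>f\<close> and \<open>b + J c\<close> are holomorphic and agree on the real axis. The pair
  \<open>(b, c)\<close> is a holomorphic function with values in \<open>\<H> \<otimes>\<^sub>\<real> \<complex>\<close>, and the regular product and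
  conjugate of slice regular functions correspond to operations of that algebra; hence they are
  slice regular again.

  The central fact is \<open>divides_near_iff\<close>: for \<open>I' \<in> \<S>\<close>, the factor \<open>q - (x + y I')\<close> divides
  \<open>g = b + J c\<close> near \<open>C\<close> if and only if \<open>b + I' c = 0\<close>. Necessity is a computation with the
  coefficients. For sufficiency when \<open>y > 0\<close>, let \<open>p'\<close> be the conjugate of \<open>x + y I'\<close> and
  \<open>N (q) = (q - x)\<^sup>2 + y\<^sup>2\<close>. The product \<open>(q - p') * g\<close> vanishes on \<open>C\<close>, and
  \<open>N\<^sup>-\<^sup>1 ((q - p') * g)\<close> extends across \<open>C\<close> by removal of singularities on each slice
  (\<open>slice_regular_divide\<close>). Its domain is \<open>\<Omega>\<close> without those points of the sphere where the
  condition on the coefficients fails; this is still a slice domain, as each slice loses at most two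
  points. When \<open>y = 0\<close>, the condition is \<open>g x = 0\<close>, and \<open>g\<close> is divided by \<open>q - x\<close> directly.

  The three assertions follow. At a point \<open>p = x + y I\<close> with \<open>f p \<noteq> 0\<close>,
  \<open>(f * g)(p) = f p b + I (f p) c = f p (b + I' c)\<close> with \<open>I' = (f p)\<^sup>-\<^sup>1 I (f p)\<close>, where \<open>b, c\<close>
  belong to \<open>g\<close>. The symmetrization of \<open>f = b + J c\<close> is
  \<open>|b|\<^sup>2 - |c|\<^sup>2 + 2 J \<langle>b, c\<rangle>\<close> on \<open>C\<close>; it vanishes at one point or at all points of \<open>C\<close>,
  according to whether \<open>|b| = |c|\<close> and \<open>\<langle>b, c\<rangle> = 0\<close>. This is the condition for
  \<open>b + I' c = 0\<close> to have a solution \<open>I' \<in> \<S>\<close> (\<open>exists_unit_zero_iff\<close>), and it is invariant under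
  conjugation of both \<open>b\<close> and \<open>c\<close>.
\<close>

section \<open>Slice coordinates\<close>

text \<open>
  The point \<open>Re z + Im z I\<close> of \<open>\<H>\<close>: for \<open>I \<in> \<S>\<close>, the isomorphism of \<open>\<complex>\<close> onto the slice \<open>L\<^sub>I\<close>.
\<close>

definition slc :: "quat \<Rightarrow> complex \<Rightarrow> quat" where
  "slc I z = of_real (Re z) + Im z *\<^sub>R I"

text \<open>
  Left multiplication by \<open>I\<close> makes \<open>\<H>\<close> a complex vector space. The map \<open>cmp I u\<close> is the
  complex-linear functional whose real part is \<open>q \<mapsto> \<langle>q, u\<rangle>\<close> (see \<open>cmp_slc_mult\<close>).
\<close>

definition cmp :: "quat \<Rightarrow> quat \<Rightarrow> quat \<Rightarrow> complex" where
  "cmp I u q = Complex (inner q u) (- inner (I * q) u)"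

lemma imag_units_iff: "I \<in> imag_units \<longleftrightarrow> qRe I = 0 \<and> norm I = 1"
proof
  assume "I \<in> imag_units"
  then have I: "I * I = -1"
    by (simp add: imag_units_def power2_eq_square)
  then have "norm I * norm I = 1"
    using norm_mult[of I I] unfolding I by simp
  then have n: "norm I = 1"
    using power2_eq_1_iff[of "norm I"] norm_ge_zero[of I] by (simp add: power2_eq_square)
  from I have e: "qRe I * qRe I - qI I * qI I - qJ I * qJ I - qK I * qK I = -1"
    by (simp add: quat_eq_iff)
  have "qRe I * qRe I + qI I * qI I + qJ I * qJ I + qK I * qK I = 1"
    using n by (simp add: norm_eq_1 inner_quat_def)
  with e have "qRe I * qRe I = 0" by linarith
  with n show "qRe I = 0 \<and> norm I = 1" by simp
next
  assume "qRe I = 0 \<and> norm I = 1"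
  then have "qRe I = 0" "qI I * qI I + qJ I * qJ I + qK I * qK I = 1"
    by (auto simp add: norm_eq_1 inner_quat_def)
  then show "I \<in> imag_units"
    by (simp add: imag_units_def power2_eq_square quat_eq_iff algebra_simps)
qed

lemma imag_units_mult_self: "I \<in> imag_units \<Longrightarrow> I * I = -1"
  by (simp add: imag_units_def power2_eq_square)

lemma imag_units_mult_self': "I \<in> imag_units \<Longrightarrow> I * (I * q) = - q"
  using mult.assoc[of I I q] by (simp add: imag_units_mult_self)

lemma imag_units_uminus: "I \<in> imag_units \<Longrightarrow> - I \<in> imag_units"
  by (simp add: imag_units_def)

lemma imag_units_conjugate:
  assumes "I \<in> imag_units" "q \<noteq> 0"
  shows "inverse q * I * q \<in> imag_units"
proof -
  have "(inverse q * I * q) * (inverse q * I * q) = inverse q * I * (q * inverse q) * I * q"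
    by (simp only: mult.assoc)
  also have "q * inverse q = 1"
    using assms(2) by (rule right_inverse)
  also have "inverse q * I * 1 * I * q = inverse q * (I * I) * q"
    by (simp only: mult.assoc mult_1_right mult_1_left)
  also have "\<dots> = - (inverse q * q)"
    by (simp only: imag_units_mult_self[OF assms(1)] mult_minus_right mult_1_right mult_minus_left)
  also have "inverse q * q = 1"
    using assms(2) by (rule left_inverse)
  finally show ?thesis
    by (simp only: imag_units_def power2_eq_square mem_Collect_eq)
qed

lemma imag_units_ne_0: "I \<in> imag_units \<Longrightarrow> I \<noteq> 0"
  by (auto simp: imag_units_iff)

lemma imag_units_nonempty:
  obtains I where "I \<in> imag_units"
  by (rule that [of "Quat 0 1 0 0"]) (simp add: imag_units_iff norm_quat_def inner_quat_def)

lemma slc_sel: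
  assumes "I \<in> imag_units"
  shows "qRe (slc I z) = Re z" "qI (slc I z) = Im z * qI I"
    "qJ (slc I z) = Im z * qJ I" "qK (slc I z) = Im z * qK I"
  using assms by (auto simp: slc_def imag_units_iff)

lemma qIm_slc: "I \<in> imag_units \<Longrightarrow> qIm (slc I z) = Im z *\<^sub>R I"
  by (auto simp: slc_def imag_units_iff qIm_def quat_eq_iff)

lemma norm_qIm_slc: "I \<in> imag_units \<Longrightarrow> norm (qIm (slc I z)) = \<bar>Im z\<bar>"
  by (simp add: qIm_slc) (simp add: imag_units_iff)

lemma slc_of_real [simp]: "slc I (of_real r) = of_real r"
  by (simp add: slc_def)

lemma slc_cnj: "slc I (cnj z) = slc (- I) z"
  by (simp add: slc_def)

lemma slc_add: "slc I (z + w) = slc I z + slc I w"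
  by (simp add: slc_def algebra_simps)

lemma slc_diff: "slc I (z - w) = slc I z - slc I w"
  by (simp add: slc_def algebra_simps)

lemma slc_mult:
  assumes "I \<in> imag_units"
  shows "slc I (z * w) = slc I z * slc I w"
  using imag_units_mult_self[OF assms]
  by (simp add: slc_def of_real_def distrib_left distrib_right
      scaleR_diff_left scaleR_add_left scaleR_diff_right scaleR_add_right mult.commute)

lemma slc_eq_0: "I \<in> imag_units \<Longrightarrow> slc I z = 0 \<longleftrightarrow> z = 0"
proof
  assume I: "I \<in> imag_units" and "slc I z = 0"
  then have "Re z = 0" "Im z *\<^sub>R I = 0"
    using slc_sel(1)[OF I, of z] by (auto simp: slc_def)
  then show "z = 0"
    using imag_units_ne_0[OF I] by (simp add: complex_eq_iff)
qed (simp add: slc_def)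

lemma slc_inj: "I \<in> imag_units \<Longrightarrow> slc I z = slc I w \<longleftrightarrow> z = w"
  using slc_eq_0[of I "z - w"] by (simp add: slc_diff)

lemma slc_eq_iff:
  assumes "I \<in> imag_units" "J \<in> imag_units"
  shows "slc I z = slc J w \<longleftrightarrow> Re z = Re w \<and> Im z *\<^sub>R I = Im w *\<^sub>R J"
proof
  assume e: "slc I z = slc J w"
  then have "Re z = Re w"
    using slc_sel(1)[OF assms(1), of z] slc_sel(1)[OF assms(2), of w] by simp
  with e show "Re z = Re w \<and> Im z *\<^sub>R I = Im w *\<^sub>R J"
    by (simp add: slc_def)
qed (simp add: slc_def)

lemma slc_in_Reals_iff: "I \<in> imag_units \<Longrightarrow> slc I z \<in> \<real> \<longleftrightarrow> Im z = 0"
proof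
  assume I: "I \<in> imag_units" and "slc I z \<in> \<real>"
  then obtain r where "slc I z = of_real r"
    by (auto elim: Reals_cases)
  then have "slc I z = slc I (of_real r)"
    by (simp only: slc_of_real)
  then have "z = of_real r"
    using I by (simp only: slc_inj)
  then show "Im z = 0"
    by simp
qed (simp add: slc_def)

lemma slc_surj:
  obtains I z where "I \<in> imag_units" "0 \<le> Im z" "q = slc I z"
proof (cases "qIm q = 0")
  case True
  obtain I where I: "I \<in> imag_units"
    by (rule imag_units_nonempty)
  have "q = slc I (of_real (qRe q))"
    using True by (simp add: quat_eq_iff qIm_def)
  with I show ?thesis
    by (intro that[of I "of_real (qRe q)"]) auto
next
  case False
  define I where "I = qIm q /\<^sub>R norm (qIm q)"
  have "I \<in> imag_units"
    using False by (simp add: imag_units_iff I_def qIm_def)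
  moreover have "q = slc I (Complex (qRe q) (norm (qIm q)))"
    using False by (simp add: I_def slc_def) (simp add: quat_eq_iff qIm_def)
  ultimately show ?thesis
    by (intro that[of I "Complex (qRe q) (norm (qIm q))"]) auto
qed

lemma qsphere_eq: "qsphere (Re z) (Im z) = (\<lambda>I. slc I z) ` imag_units"
  by (auto simp: qsphere_def slc_def)

lemma qsphere_abs: "qsphere x \<bar>y\<bar> = qsphere x y"
proof (cases "y \<ge> 0")
  case False
  have sub: "qsphere x (-y) \<subseteq> qsphere x y" for y
  proof
    fix q assume "q \<in> qsphere x (-y)"
    then obtain J where "J \<in> imag_units" "q = of_real x + (-y) *\<^sub>R J"
      unfolding qsphere_def by blast
    then have "q = of_real x + y *\<^sub>R (-J)" "-J \<in> imag_units"
      by (auto simp: imag_units_uminus)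
    then show "q \<in> qsphere x y"
      unfolding qsphere_def by blast
  qed
  have "qsphere x (-y) = qsphere x y"
    using sub[of y] sub[of "-y"] by simp
  with False show ?thesis by simp
qed simp

lemma slice_plane_eq: "slice_plane I = range (slc I)"
proof -
  have "of_real x + y *\<^sub>R I \<in> range (slc I)" for x y
    by (rule range_eqI[of _ _ "Complex x y"]) (simp add: slc_def)
  then show ?thesis
    unfolding slice_plane_def by (auto simp: slc_def)
qed

lemma continuous_slc2 [continuous_intros]:
  assumes "continuous_on A f" "continuous_on A g"
  shows "continuous_on A (\<lambda>t. slc (f t) (g t))"
  unfolding slc_def by (intro continuous_intros assms)

lemma open_vimage_slc:
  assumes "open \<Omega>"
  shows "open {z. slc I z \<in> \<Omega>}"
proof -
  have "open (slc I -` \<Omega>)"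
    by (intro open_vimage assms continuous_intros)
  then show ?thesis by (simp add: vimage_def)
qed

lemma closed_imag_units: "closed imag_units"
proof -
  have "closed ((\<lambda>J :: quat. J\<^sup>2) -` {-1})"
    by (intro closed_vimage continuous_intros closed_singleton)
  then show ?thesis
    by (simp add: imag_units_def vimage_def)
qed

lemma closed_qsphere: "closed (qsphere x y)"
proof -
  have "compact imag_units"
    unfolding compact_eq_bounded_closed
    using closed_imag_units by (auto simp: bounded_iff imag_units_iff intro!: exI[of _ 1])
  then have "compact ((\<lambda>I. slc I (Complex x y)) ` imag_units)"
    by (intro compact_continuous_image continuous_intros)
  then show ?thesis
    using qsphere_eq[of "Complex x y"] by (simp add: compact_imp_closed)
qed

text \<open>The set \<open>\<S>\<close> has no isolated points.\<close>

lemma imag_units_perfect: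
  assumes "I \<in> imag_units" "open V" "I \<in> V"
  obtains K where "K \<in> imag_units" "K \<in> V" "K \<noteq> I"
proof -
  define i j where "i = Quat 0 1 0 0" and "j = Quat 0 0 1 0"
  obtain v where v: "v \<in> imag_units" "v \<noteq> I" "v \<noteq> - I"
  proof (cases "I = i \<or> I = - i")
    case True
    show ?thesis
      by (rule that[of j]; use True in
          \<open>auto simp: i_def j_def imag_units_iff norm_quat_def inner_quat_def quat_eq_iff\<close>)
  next
    case False
    show ?thesis
      by (rule that[of i]; use False in
          \<open>auto simp: i_def j_def imag_units_iff norm_quat_def inner_quat_def quat_eq_iff\<close>)
  qed
  \<comment> \<open>Rotate \<open>I\<close> slightly towards a unit \<open>v\<close> that is not parallel to it.\<close>
  define K where "K t = (I + t *\<^sub>R v) /\<^sub>R norm (I + t *\<^sub>R v)" for t :: real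
  have nI: "norm I = 1" and nv: "norm v = 1"
    using assms v by (auto simp: imag_units_iff)
  have "(K \<longlongrightarrow> (I + 0 *\<^sub>R v) /\<^sub>R norm (I + 0 *\<^sub>R v)) (at 0)"
    unfolding K_def by (intro tendsto_intros) (simp_all add: nI)
  then have "(K \<longlongrightarrow> I) (at 0)"
    by (simp add: nI)
  then have "\<forall>\<^sub>F t in at 0. K t \<in> V"
    using assms by (simp add: topological_tendstoD)
  moreover have "\<forall>\<^sub>F t in at 0. t \<in> ball 0 1 - {0::real}"
    by (rule eventually_at_in_open) auto
  ultimately have "\<forall>\<^sub>F t in at (0::real). K t \<in> V \<and> t \<in> ball 0 1 - {0}"
    by (rule eventually_conj)
  then obtain t where t: "K t \<in> V" "t \<in> ball 0 1" "t \<noteq> 0"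
    using eventually_happens by fastforce
  have nz: "norm (I + t *\<^sub>R v) \<noteq> 0"
  proof
    assume "norm (I + t *\<^sub>R v) = 0"
    then have "I = - (t *\<^sub>R v)"
      by (simp add: eq_neg_iff_add_eq_0)
    then have "norm I = \<bar>t\<bar> * norm v" by simp
    with nI nv t show False by simp
  qed
  have "qRe (K t) = 0"
    using assms v by (simp add: K_def imag_units_iff)
  moreover have "norm (K t) = 1"
    using nz by (simp add: K_def)
  ultimately have "K t \<in> imag_units"
    by (simp add: imag_units_iff)
  moreover have "K t \<noteq> I"
  proof
    assume "K t = I"
    then have "norm (I + t *\<^sub>R v) *\<^sub>R I = norm (I + t *\<^sub>R v) *\<^sub>R K t"
      by simp
    also have "\<dots> = I + t *\<^sub>R v"
      using nz by (simp add: K_def)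
    finally have "t *\<^sub>R v = (norm (I + t *\<^sub>R v) - 1) *\<^sub>R I"
      by (simp add: algebra_simps)
    then obtain r where r: "t *\<^sub>R v = r *\<^sub>R I" ..
    define s where "s = inverse t * r"
    have "v = inverse t *\<^sub>R (t *\<^sub>R v)"
      using t by simp
    then have s: "v = s *\<^sub>R I"
      by (simp only: r s_def scaleR_scaleR)
    have "\<bar>s\<bar> = 1"
      using nI nv arg_cong[OF s, of norm] by simp
    then have "s = 1 \<or> s = -1" by linarith
    with s v show False by auto
  qed
  ultimately show ?thesis
    using that t by blast
qed

section \<open>Slice regularity in terms of holomorphic functions\<close>

lemma bounded_linear_cmp: "bounded_linear (cmp I u)"
proof -
  have "bounded_linear (\<lambda>q. complex_of_real (inner q u) + \<i> * complex_of_real (- inner (I * q) u))"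
    by (intro bounded_linear_add bounded_linear_const_mult bounded_linear_minus
        bounded_linear_compose[OF bounded_linear_of_real]
        bounded_linear_compose[OF bounded_linear_inner_left]
        bounded_linear_mult_right bounded_linear_inner_left)
  also have "(\<lambda>q. complex_of_real (inner q u) + \<i> * complex_of_real (- inner (I * q) u)) = cmp I u"
    by (auto simp: cmp_def complex_eq_iff)
  finally show ?thesis .
qed

lemma cmp_add: "cmp I u (p + q) = cmp I u p + cmp I u q"
  by (simp add: cmp_def inner_add_left algebra_simps complex_eq_iff)

lemma cmp_scaleR: "cmp I u (r *\<^sub>R p) = of_real r * cmp I u p"
  by (simp add: cmp_def complex_eq_iff)

lemma cmp_mult_unit: "I \<in> imag_units \<Longrightarrow> cmp I u (I * q) = \<i> * cmp I u q"
  by (simp add: cmp_def complex_eq_iff imag_units_mult_self')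

lemma cmp_slc_mult: "I \<in> imag_units \<Longrightarrow> cmp I u (slc I z * q) = z * cmp I u q"
  by (simp add: slc_def of_real_def distrib_right cmp_add cmp_scaleR cmp_mult_unit)
     (simp add: complex_eq_iff)

lemma quat_eqI_cmp:
  assumes "\<And>u. cmp I u p = cmp I u q"
  shows "p = q"
proof -
  have "inner (p - q) u = 0" for u
    using arg_cong[OF assms[of u], of Re] by (simp add: cmp_def inner_diff_left)
  then show ?thesis
    using inner_eq_zero_iff[of "p - q"] by simp
qed

lemma Complex_has_derivatives:
  "((\<lambda>t. Complex t y) has_derivative (\<lambda>h. of_real h)) (at s)"
  "((\<lambda>t. Complex x t) has_derivative (\<lambda>h. \<i> * of_real h)) (at s)"
  unfolding Complex_eq by (auto intro!: derivative_eq_intros)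

text \<open>
  Continuous partial derivatives make \<open>f\<close> real differentiable on each slice, and the
  Cauchy-Riemann equation turns each coordinate \<open>cmp I u\<close> of \<open>f\<close> into a holomorphic function.
\<close>

lemma slice_regularD:
  assumes "open \<Omega>" and f: "slice_regular \<Omega> f" and I: "I \<in> imag_units"
  shows "(\<lambda>z. cmp I u (f (slc I z))) holomorphic_on {z. slc I z \<in> \<Omega>}"
proof -
  define D where "D = {(x, y). of_real x + y *\<^sub>R I \<in> \<Omega>}"
  obtain fx fy :: "real \<times> real \<Rightarrow> quat" where
    cy: "continuous_on D fy" and
    dx: "\<And>x y. (x, y) \<in> D \<Longrightarrow> ((\<lambda>t. f (of_real t + y *\<^sub>R I)) has_vector_derivative fx (x, y)) (at x)" and
    dy: "\<And>x y. (x, y) \<in> D \<Longrightarrow> ((\<lambda>t. f (of_real x + t *\<^sub>R I)) has_vector_derivative fy (x, y)) (at y)" and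
    cr: "\<And>x y. (x, y) \<in> D \<Longrightarrow> (1 / 2) *\<^sub>R (fx (x, y) + I * fy (x, y)) = 0"
    using f I unfolding slice_regular_def Let_def D_def by blast
  have oD: "open D"
  proof -
    have "open ((\<lambda>p. of_real (fst p) + snd p *\<^sub>R I) -` \<Omega>)"
      by (intro open_vimage assms continuous_intros)
    then show ?thesis
      by (simp add: D_def vimage_def case_prod_unfold)
  qed
  define g where "g x y = cmp I u (f (of_real x + y *\<^sub>R I))" for x y
  have bl: "bounded_linear (cmp I u)"
    by (rule bounded_linear_cmp)
  have "(\<lambda>z. cmp I u (f (slc I z))) field_differentiable (at z within {z. slc I z \<in> \<Omega>})"
    if z: "slc I z \<in> \<Omega>" for z
  proof -
    define x0 y0 where "x0 = Re z" and "y0 = Im z"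
    have "(x0, y0) \<in> D"
      using z by (simp add: D_def x0_def y0_def slc_def)
    then obtain A B where AB: "open A" "open B" "x0 \<in> A" "y0 \<in> B" "A \<times> B \<subseteq> D"
      using open_prod_elim[OF oD] by (metis mem_Sigma_iff)
    obtain e where e: "e > 0" "ball y0 e \<subseteq> B"
      using AB open_contains_ball by blast
    define Y where "Y = ball y0 e"
    have Y: "open Y" "convex Y" "y0 \<in> Y" "A \<times> Y \<subseteq> D"
      using e AB by (auto simp: Y_def)
    have gx: "((\<lambda>x. g x y0) has_derivative (\<lambda>h. h *\<^sub>R cmp I u (fx (x0, y0)))) (at x0 within A)"
      unfolding g_def
      using bounded_linear.has_vector_derivative[OF bl dx[OF \<open>(x0, y0) \<in> D\<close>]]
      by (simp add: has_vector_derivative_def has_derivative_at_withinI)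
    have gy: "((\<lambda>y. g x y) has_derivative blinfun_apply (blinfun_scaleR_left (cmp I u (fy (x, y))))) (at y within Y)"
      if "x \<in> A" "y \<in> Y" for x y
      unfolding g_def
      using bounded_linear.has_vector_derivative[OF bl dy[of x y]] that Y
      by (auto simp: has_vector_derivative_def has_derivative_at_withinI)
    have "continuous_on (A \<times> Y) (\<lambda>p. blinfun_scaleR_left (cmp I u (fy p)))"
      by (intro continuous_intros bounded_linear.continuous_on[OF bl]
          bounded_linear.continuous_on[OF bounded_linear_blinfun_scaleR_left]
          continuous_on_subset[OF cy] Y)
    then have gc: "continuous (at (x0, y0) within A \<times> Y) (\<lambda>(x, y). blinfun_scaleR_left (cmp I u (fy (x, y))))"
      using AB Y by (auto simp: continuous_on_eq_continuous_within case_prod_unfold)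
    have "((\<lambda>(x, y). g x y) has_derivative
            (\<lambda>(tx, ty). tx *\<^sub>R cmp I u (fx (x0, y0)) + blinfun_scaleR_left (cmp I u (fy (x0, y0))) ty))
          (at (x0, y0) within A \<times> Y)"
      by (rule has_derivative_partialsI[OF gx gy gc Y(3,2)])
    moreover have "at (x0, y0) within A \<times> Y = at (x0, y0)"
      using AB Y by (intro at_within_open open_Times) auto
    ultimately have dg: "((\<lambda>(x, y). g x y) has_derivative
            (\<lambda>(tx, ty). tx *\<^sub>R cmp I u (fx (x0, y0)) + ty *\<^sub>R cmp I u (fy (x0, y0))))
          (at (Re z, Im z))"
      by (simp add: x0_def y0_def)
    have dp: "((\<lambda>w. (Re w, Im w)) has_derivative (\<lambda>w. (Re w, Im w))) (at z)"
      by (intro derivative_intros bounded_linear_imp_has_derivative bounded_linear_Re bounded_linear_Im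
          has_derivative_Pair)
    have "fx (x0, y0) + I * fy (x0, y0) = 0"
      using cr[OF \<open>(x0, y0) \<in> D\<close>] by simp
    then have "cmp I u (fx (x0, y0) + I * fy (x0, y0)) = 0"
      by (simp add: cmp_def complex_eq_iff)
    then have "cmp I u (fx (x0, y0)) + \<i> * cmp I u (fy (x0, y0)) = 0"
      by (simp add: cmp_add cmp_mult_unit[OF I])
    then have "\<i> * (cmp I u (fx (x0, y0)) + \<i> * cmp I u (fy (x0, y0))) = 0"
      by simp
    then have b: "cmp I u (fy (x0, y0)) = \<i> * cmp I u (fx (x0, y0))"
      by (simp add: algebra_simps)
    have "((\<lambda>w. g (Re w) (Im w)) has_derivative (\<lambda>w. cmp I u (fx (x0, y0)) * w)) (at z)"
    proof (rule has_derivative_eq_rhs)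
      show "((\<lambda>w. g (Re w) (Im w)) has_derivative
             (\<lambda>w. Re w *\<^sub>R cmp I u (fx (x0, y0)) + Im w *\<^sub>R cmp I u (fy (x0, y0)))) (at z)"
        using has_derivative_compose[OF dp dg] by simp
    qed (simp add: b fun_eq_iff complex_eq_iff algebra_simps)
    then have "((\<lambda>z. cmp I u (f (slc I z))) has_field_derivative cmp I u (fx (x0, y0))) (at z)"
      by (simp add: has_field_derivative_def g_def slc_def)
    then show ?thesis
      using field_differentiable_at_within field_differentiable_def by blast
  qed
  then show ?thesis
    by (intro holomorphic_onI) auto
qed

lemma quat_sum_inner_Basis: "q = (\<Sum>e\<in>Basis. Re (cmp I e q) *\<^sub>R e)"
  by (simp add: cmp_def euclidean_representation)

text \<open>
  If all coordinates of \<open>F\<close> are holomorphic, the real derivative of \<open>F\<close> is complex linear for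
  left multiplication by \<open>I\<close>, so it is determined by its value \<open>v\<close> at 1.
\<close>

lemma cmp_holomorphic_has_derivative:
  assumes I: "I \<in> imag_units" and D: "open D" "z \<in> D"
    and hol: "\<And>u. (\<lambda>z. cmp I u (F z)) holomorphic_on D"
  obtains v where "(F has_derivative (\<lambda>w. slc I w * v)) (at z)"
    "\<And>u. deriv (\<lambda>z. cmp I u (F z)) z = cmp I u v"
proof -
  define d where "d u = deriv (\<lambda>z. cmp I u (F z)) z" for u
  have d: "((\<lambda>z. cmp I u (F z)) has_derivative (\<lambda>w. d u * w)) (at z)" for u
    using holomorphic_derivI[OF hol D, of u] by (simp add: has_field_derivative_def d_def)
  define L where "L w = (\<Sum>e\<in>Basis. Re (d e * w) *\<^sub>R e)" for w
  have "((\<lambda>z. inner (F z) e) has_derivative (\<lambda>w. inner (L w) e)) (at z)" if "e \<in> Basis" for e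
  proof -
    have "inner (L w) e = Re (d e * w)" for w
      unfolding L_def using that by (rule inner_sum_left_Basis)
    moreover have "((\<lambda>z. Re (cmp I e (F z))) has_derivative (\<lambda>w. Re (d e * w))) (at z)"
      by (intro bounded_linear.has_derivative[OF bounded_linear_Re] d)
    ultimately show ?thesis
      by (simp add: cmp_def)
  qed
  then have dF: "(F has_derivative L) (at z)"
    by (subst has_derivative_componentwise_within) auto
  have L: "cmp I u (L w) = d u * w" for u w
    using has_derivative_unique[OF bounded_linear.has_derivative[OF bounded_linear_cmp dF] d]
    by (simp add: fun_eq_iff)
  have "L = (\<lambda>w. slc I w * L 1)"
    by (intro ext quat_eqI_cmp[of I]) (simp add: cmp_slc_mult[OF I] L)
  with dF L show ?thesis
    by (intro that[of "L 1"]) (auto simp: d_def)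
qed

lemma slice_regularI:
  assumes "open \<Omega>"
    and hol: "\<And>I u. I \<in> imag_units \<Longrightarrow> (\<lambda>z. cmp I u (f (slc I z))) holomorphic_on {z. slc I z \<in> \<Omega>}"
  shows "slice_regular \<Omega> f"
  unfolding slice_regular_def Let_def
proof (intro ballI)
  fix I assume I: "I \<in> imag_units"
  define D where "D = {z. slc I z \<in> \<Omega>}"
  have oD: "open D"
    unfolding D_def using assms(1) by (rule open_vimage_slc)
  have "\<forall>z\<in>D. \<exists>v. ((\<lambda>z. f (slc I z)) has_derivative (\<lambda>w. slc I w * v)) (at z) \<and>
      (\<forall>u. deriv (\<lambda>z. cmp I u (f (slc I z))) z = cmp I u v)"
    using cmp_holomorphic_has_derivative[OF I oD _ hol[OF I, folded D_def]] by metis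
  then obtain v where
    v: "\<And>z. z \<in> D \<Longrightarrow> ((\<lambda>z. f (slc I z)) has_derivative (\<lambda>w. slc I w * v z)) (at z)"
    and dv: "\<And>z u. z \<in> D \<Longrightarrow> deriv (\<lambda>z. cmp I u (f (slc I z))) z = cmp I u (v z)"
    by metis
  have "continuous_on D (\<lambda>z. \<Sum>e\<in>Basis. Re (deriv (\<lambda>z. cmp I e (f (slc I z))) z) *\<^sub>R e)"
    by (intro continuous_intros holomorphic_on_imp_continuous_on holomorphic_deriv oD
        hol[OF I, folded D_def])
  then have cv: "continuous_on D v"
    by (rule continuous_on_eq) (simp add: dv flip: quat_sum_inner_Basis)
  define fx where "fx p = v (Complex (fst p) (snd p))" for p
  define E where "E = {(x, y). of_real x + y *\<^sub>R I \<in> \<Omega>}"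
  have E: "(x, y) \<in> E \<longleftrightarrow> Complex x y \<in> D" for x y
    by (simp add: E_def D_def slc_def)
  have cfx: "continuous_on E fx"
    unfolding fx_def
  proof (rule continuous_on_compose2[OF cv])
    show "continuous_on E (\<lambda>p. Complex (fst p) (snd p))"
      unfolding Complex_eq by (intro continuous_intros)
  qed (auto simp: E)
  have "((\<lambda>t. f (of_real t + y *\<^sub>R I)) has_vector_derivative fx (x, y)) (at x)"
    if "(x, y) \<in> E" for x y
  proof -
    have "((\<lambda>t. f (slc I (Complex t y))) has_derivative (\<lambda>h. slc I (of_real h) * v (Complex x y))) (at x)"
      by (rule has_derivative_compose[OF Complex_has_derivatives(1) v]) (use that in \<open>simp add: E\<close>)
    then show ?thesis
      by (simp add: slc_def has_vector_derivative_def fx_def scaleR_conv_of_real)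
  qed
  moreover have "((\<lambda>t. f (of_real x + t *\<^sub>R I)) has_vector_derivative I * fx (x, y)) (at y)"
    if "(x, y) \<in> E" for x y
  proof -
    have "((\<lambda>t. f (slc I (Complex x t))) has_derivative (\<lambda>h. slc I (\<i> * of_real h) * v (Complex x y))) (at y)"
      by (rule has_derivative_compose[OF Complex_has_derivatives(2) v]) (use that in \<open>simp add: E\<close>)
    then show ?thesis
      by (simp add: slc_def has_vector_derivative_def fx_def)
  qed
  moreover have "(1 / 2) *\<^sub>R (fx p + I * (I * fx p)) = 0" for p
    using imag_units_mult_self'[OF I] by simp
  moreover have "continuous_on E (\<lambda>p. I * fx p)"
    by (intro continuous_intros cfx)
  ultimately show "\<exists>fx fy. continuous_on {(x, y). of_real x + y *\<^sub>R I \<in> \<Omega>} fx \<and>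
            continuous_on {(x, y). of_real x + y *\<^sub>R I \<in> \<Omega>} fy \<and>
            (\<forall>(x, y)\<in>{(x, y). of_real x + y *\<^sub>R I \<in> \<Omega>}.
                ((\<lambda>t. f (of_real t + y *\<^sub>R I)) has_vector_derivative fx (x, y)) (at x) \<and>
                ((\<lambda>t. f (of_real x + t *\<^sub>R I)) has_vector_derivative fy (x, y)) (at y) \<and>
                (1 / 2) *\<^sub>R (fx (x, y) + I * fy (x, y)) = 0)"
    unfolding E_def[symmetric] using cfx by (intro exI[of _ fx] exI[of _ "\<lambda>p. I * fx p"]) auto
qed

lemma slice_regular_subset:
  assumes "open \<Omega>" "slice_regular \<Omega> f" "open \<Lambda>" "\<Lambda> \<subseteq> \<Omega>"
  shows "slice_regular \<Lambda> f"
proof (rule slice_regularI[OF assms(3)])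
  show "(\<lambda>z. cmp I u (f (slc I z))) holomorphic_on {z. slc I z \<in> \<Lambda>}" if "I \<in> imag_units" for I u
    by (rule holomorphic_on_subset[OF slice_regularD[OF assms(1,2) that]]) (use assms in auto)
qed

section \<open>Local representation\<close>

lemma slice_domain_open: "slice_domain \<Omega> \<Longrightarrow> open \<Omega>"
  by (simp add: slice_domain_def domain_of_def)

lemma slice_domain_real:
  assumes "slice_domain \<Omega>"
  obtains r where "of_real r \<in> \<Omega>"
  using assms by (auto simp: slice_domain_def elim!: Reals_cases)

lemma slice_domain_connected:
  assumes "slice_domain \<Omega>" "I \<in> imag_units"
  shows "connected {z. slc I z \<in> \<Omega>}"
proof -
  define k where "k q = Complex (qRe q) (inner q I)" for q
  have k: "k (slc I z) = z" for z
  proof -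
    have "inner (slc I z) I = Re z * qRe I + Im z * inner I I"
      by (simp add: slc_def inner_add_left) (simp add: inner_quat_def)
    also have "\<dots> = Im z"
      using assms(2) by (simp add: imag_units_iff norm_eq_1)
    finally show ?thesis
      using assms(2) by (simp add: k_def slc_sel)
  qed
  have "continuous_on UNIV k"
  proof -
    have "k = (\<lambda>q. complex_of_real (inner q 1) + \<i> * complex_of_real (inner q I))"
      by (auto simp: k_def Complex_eq inner_quat_def)
    then show ?thesis
      by (simp add: continuous_intros)
  qed
  then have "connected (k ` (\<Omega> \<inter> slice_plane I))"
    using assms by (intro connected_continuous_image)
      (auto simp: slice_domain_def domain_of_def intro: continuous_on_subset)
  moreover have "k ` (\<Omega> \<inter> slice_plane I) = {z. slc I z \<in> \<Omega>}"
  proof (intro equalityI subsetI)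
    fix z assume "z \<in> {z. slc I z \<in> \<Omega>}"
    then have "k (slc I z) \<in> k ` (\<Omega> \<inter> slice_plane I)"
      by (intro imageI) (auto simp: slice_plane_eq)
    then show "z \<in> k ` (\<Omega> \<inter> slice_plane I)"
      by (simp only: k)
  qed (auto simp: slice_plane_eq k)
  ultimately show ?thesis by simp
qed

text \<open>
  The complex functions \<open>\<langle>b, u\<rangle> + \<i> \<langle>c, u\<rangle>\<close> are the coordinates of the function \<open>b + \<i> c\<close> with
  values in \<open>\<H> \<otimes>\<^sub>\<real> \<complex>\<close>.
\<close>

definition stem_cmp :: "(complex \<Rightarrow> quat) \<Rightarrow> (complex \<Rightarrow> quat) \<Rightarrow> quat \<Rightarrow> complex \<Rightarrow> complex" where
  "stem_cmp b c u z = Complex (inner (b z) u) (inner (c z) u)"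

text \<open>
  The pair \<open>(b, c)\<close> is a holomorphic stem if \<open>b + \<i> c\<close> is holomorphic, coordinate by coordinate. It
  induces the function \<open>b z + I c z\<close> of the point \<open>slc I z\<close>.
\<close>

definition holomorphic_stem :: "complex set \<Rightarrow> (complex \<Rightarrow> quat) \<Rightarrow> (complex \<Rightarrow> quat) \<Rightarrow> bool" where
  "holomorphic_stem D b c \<longleftrightarrow> (\<forall>u. stem_cmp b c u holomorphic_on D)"

lemma inner_unit_mult:
  assumes "I \<in> imag_units"
  shows "inner (I * p) q = - inner p (I * q)"
  using assms by (simp add: imag_units_iff inner_quat_def algebra_simps)

lemma cmp_stem:
  assumes "I \<in> imag_units"
  shows "cmp I u (b z + I * c z) = stem_cmp b c u z + \<i> * stem_cmp b c (I * u) z"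
  using assms
  by (simp add: cmp_def stem_cmp_def complex_eq_iff inner_add_left inner_diff_left distrib_left
      imag_units_mult_self' inner_unit_mult)

lemma holomorphic_stem_cmp:
  assumes "I \<in> imag_units" "holomorphic_stem D b c"
  shows "(\<lambda>z. cmp I u (b z + I * c z)) holomorphic_on D"
  unfolding cmp_stem[OF assms(1)]
  using assms(2) by (intro holomorphic_intros) (auto simp: holomorphic_stem_def)

lemma mult_inverse_cancel:
  fixes x y :: "'a::division_ring"
  assumes "x \<noteq> 0"
  shows "x * (inverse x * y) = y"
  using right_inverse[OF assms] by (simp only: mult.assoc[symmetric] mult_1_left)

text \<open>
  Holomorphic functions on two different slices determine a holomorphic stem: from
  \<open>cmp_stem\<close> one gets \<open>cmp J w (F z) - cmp K w (G z) = \<i> s\<close>, where \<open>s\<close> is the coordinate of the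
  stem along \<open>(J - K) w\<close>, and \<open>J - K\<close> is invertible.
\<close>

lemma holomorphic_stem_of_slices:
  assumes JK: "J \<in> imag_units" "K \<in> imag_units" "J \<noteq> K"
    and F: "\<And>u. (\<lambda>z. cmp J u (F z)) holomorphic_on D"
    and G: "\<And>u. (\<lambda>z. cmp K u (G z)) holomorphic_on D"
    and c: "\<And>z. c z = inverse (J - K) * (F z - G z)"
    and b: "\<And>z. b z = F z - J * c z"
  shows "holomorphic_stem D b c"
  unfolding holomorphic_stem_def
proof
  fix v
  define w where "w = inverse (J - K) * v"
  have nz: "J - K \<noteq> 0" using JK by simp
  have w: "J * w - K * w = v"
    unfolding left_diff_distrib[symmetric] w_def using nz by (rule mult_inverse_cancel)
  have FJ: "F z = b z + J * c z" for z
    by (simp add: b)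
  have JK_c: "J * c z - K * c z = F z - G z" for z
    unfolding left_diff_distrib[symmetric] c using nz by (rule mult_inverse_cancel)
  have GK: "G z = b z + K * c z" for z
  proof -
    have "b z + K * c z = F z - (J * c z - K * c z)"
      by (simp add: b)
    then show ?thesis
      by (simp add: JK_c)
  qed
  have "stem_cmp b c v = (\<lambda>z. - \<i> * (cmp J w (F z) - cmp K w (G z)))"
    unfolding FJ GK cmp_stem[OF JK(1)] cmp_stem[OF JK(2)]
    by (rule ext) (simp add: w[symmetric] stem_cmp_def complex_eq_iff inner_diff_right)
  moreover have "(\<lambda>z. - \<i> * (cmp J w (F z) - cmp K w (G z))) holomorphic_on D"
    by (intro holomorphic_intros F G)
  ultimately show "stem_cmp b c v holomorphic_on D"
    by (simp only:)
qed

text \<open>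
  The tubular neighbourhood that carries the local representation: a path in \<open>\<Omega>\<^sub>I\<close> from a given point to
  the real axis is compact, so its neighbours on all slices close to \<open>L\<^sub>I\<close> also lie in \<open>\<Omega>\<close>.
\<close>

lemma slice_domain_tube:
  assumes \<Omega>: "slice_domain \<Omega>" and I: "I \<in> imag_units" and z0: "slc I z0 \<in> \<Omega>"
  obtains D V r where "open D" "connected D" "z0 \<in> D" "of_real r \<in> D" "open V" "I \<in> V"
    "\<And>z J. z \<in> D \<Longrightarrow> J \<in> V \<Longrightarrow> slc J z \<in> \<Omega>"
proof -
  obtain r where r: "of_real r \<in> \<Omega>"
    using slice_domain_real[OF \<Omega>] .
  define D0 where "D0 = {z. slc I z \<in> \<Omega>}"
  have "path_connected D0"
    unfolding D0_def using slice_domain_connected[OF \<Omega> I] open_vimage_slc slice_domain_open[OF \<Omega>]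
    by (intro connected_open_path_connected) auto
  moreover have "z0 \<in> D0" "of_real r \<in> D0"
    using z0 r by (auto simp: D0_def)
  ultimately obtain g where g: "path g" "path_image g \<subseteq> D0" "pathstart g = z0" "pathfinish g = of_real r"
    unfolding path_connected_def by blast
  define W where "W = {(J, z). slc J z \<in> \<Omega>}"
  have W: "open W"
  proof -
    have "open ((\<lambda>p. slc (fst p) (snd p)) -` \<Omega>)"
      by (intro open_vimage slice_domain_open[OF \<Omega>] continuous_intros)
    then show ?thesis
      by (simp add: W_def vimage_def case_prod_unfold)
  qed
  obtain X where X: "I \<in> X" "open X" "X \<times> path_image g \<subseteq> W"
    using Elementary_Topology.tube_lemma[OF compact_path_image[OF g(1)] W, of I] g(2) by (auto simp: W_def D0_def)
  obtain e where e: "e > 0" "cball I e \<subseteq> X"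
    using X open_contains_cball by blast
  define D1 where "D1 = {z. \<forall>J\<in>cball I e. slc J z \<in> \<Omega>}"
  have "open D1"
  proof (subst open_subopen, rule ballI)
    fix z assume z: "z \<in> D1"
    have W': "open {(w, J). slc J w \<in> \<Omega>}"
    proof -
      have "open ((\<lambda>p. slc (snd p) (fst p)) -` \<Omega>)"
        by (intro open_vimage slice_domain_open[OF \<Omega>] continuous_intros)
      then show ?thesis
        by (simp add: vimage_def case_prod_unfold)
    qed
    obtain Y where "z \<in> Y" "open Y" "Y \<times> cball I e \<subseteq> {(w, J). slc J w \<in> \<Omega>}"
      using Elementary_Topology.tube_lemma[OF compact_cball W', of z I e] z by (auto simp: D1_def)
    then show "\<exists>T. open T \<and> z \<in> T \<and> T \<subseteq> D1"
      by (intro exI[of _ Y]) (auto simp: D1_def)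
  qed
  have sub: "path_image g \<subseteq> D1"
    using X e by (force simp: D1_def W_def)
  define D where "D = connected_component_set D1 z0"
  have "path_image g \<subseteq> D"
    unfolding D_def using sub connected_path_image[OF g(1)] g(3) pathstart_in_path_image[of g]
    by (intro connected_component_maximal) auto
  moreover have "z0 \<in> path_image g" "of_real r \<in> path_image g"
    using g pathstart_in_path_image[of g] pathfinish_in_path_image[of g] by auto
  moreover have "D \<subseteq> D1"
    unfolding D_def by (rule connected_component_subset)
  moreover have "open D"
    unfolding D_def using \<open>open D1\<close> by (rule open_connected_component)
  moreover have "connected D"
    unfolding D_def by (rule connected_connected_component)
  ultimately show ?thesis
    using e by (intro that[of D r "ball I e"]) (auto simp: D1_def)
qed

text \<open>
  The function \<open>f\<close> is \<open>b + J c\<close> at the points of the sphere through \<open>slc I z\<close> whose imaginary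
  unit \<open>J\<close> is close to \<open>I\<close>, and these points lie in \<open>\<Omega>\<close>. For \<open>I \<in> \<S>\<close> and \<open>Im z > 0\<close> this is
  \<open>has_spherical_coeffs\<close> (see \<open>has_spherical_coeffs_iff\<close>); the advantage is that
  \<open>z\<close> may also be real or have negative imaginary part.
\<close>

definition sphere_pair ::
  "quat set \<Rightarrow> (quat \<Rightarrow> quat) \<Rightarrow> quat \<Rightarrow> complex \<Rightarrow> quat \<Rightarrow> quat \<Rightarrow> bool" where
  "sphere_pair \<Omega> f I z b c \<longleftrightarrow>
     (\<exists>V. open V \<and> I \<in> V \<and> (\<forall>J\<in>V \<inter> imag_units. slc J z \<in> \<Omega> \<and> f (slc J z) = b + J * c))"

text \<open>
  The local representation formula, proved from the identity theorem on each slice: near each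
  point, with both the point in the slice and the slice allowed to vary, a slice regular function
  is induced by a holomorphic stem.
\<close>

lemma local_stem:
  assumes \<Omega>: "slice_domain \<Omega>" and f: "slice_regular \<Omega> f" and I: "I \<in> imag_units"
    and z0: "slc I z0 \<in> \<Omega>"
  obtains D b c where "open D" "z0 \<in> D" "holomorphic_stem D b c"
    "\<forall>z\<in>D. sphere_pair \<Omega> f I z (b z) (c z)"
proof -
  obtain D V r where D: "open D" "connected D" "z0 \<in> D" "of_real r \<in> D" and V: "open V" "I \<in> V"
    and sub: "\<And>z J. z \<in> D \<Longrightarrow> J \<in> V \<Longrightarrow> slc J z \<in> \<Omega>"
    using slice_domain_tube[OF \<Omega> I z0] by metis
  obtain K where K: "K \<in> imag_units" "K \<in> V" "K \<noteq> I"
    using imag_units_perfect[OF I V] .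
  define c where "c z = inverse (I - K) * (f (slc I z) - f (slc K z))" for z
  define b where "b z = f (slc I z) - I * c z" for z
  have hol: "(\<lambda>z. cmp J u (f (slc J z))) holomorphic_on D" if "J \<in> imag_units" "J \<in> V" for J u
    by (rule holomorphic_on_subset[OF slice_regularD[OF slice_domain_open[OF \<Omega>] f that(1)]])
       (use sub that in auto)
  have stem: "holomorphic_stem D b c"
    by (rule holomorphic_stem_of_slices[OF I K(1) K(3)[symmetric] hol[OF I V(2)] hol[OF K(1,2)]
          c_def b_def])
  have "f (slc J z) = b z + J * c z" if z: "z \<in> D" and J: "J \<in> V" "J \<in> imag_units" for z J
  proof (rule quat_eqI_cmp[of J])
    fix u
    define d where "d z = cmp J u (f (slc J z)) - cmp J u (b z + J * c z)" for z
    have "d holomorphic_on D"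
      unfolding d_def
      by (rule holomorphic_on_diff[OF hol[OF J(2,1)] holomorphic_stem_cmp[OF J(2) stem]])
    moreover have "complex_of_real r islimpt {z \<in> D. z \<in> \<real>}"
      unfolding islimpt_approachable
    proof (intro allI impI)
      fix e :: real assume "e > 0"
      obtain e' where e': "e' > 0" "ball (of_real r) e' \<subseteq> D"
        using D open_contains_ball by blast
      define t where "t = r + min e e' / 2"
      have "dist (complex_of_real t) (of_real r) = min e e' / 2"
        unfolding dist_of_real using \<open>e > 0\<close> e' by (simp add: t_def dist_real_def)
      then have dist: "dist (complex_of_real t) (of_real r) < e" "dist (complex_of_real t) (of_real r) < e'"
        and ne: "t \<noteq> r"
        using \<open>e > 0\<close> e'(1) by auto
      from dist(2) e'(2) have "complex_of_real t \<in> D"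
        by (auto simp: dist_commute)
      with dist(1) ne show "\<exists>x'\<in>{z \<in> D. z \<in> \<real>}. x' \<noteq> complex_of_real r \<and> dist x' (complex_of_real r) < e"
        by (intro bexI[of _ "of_real t"]) simp_all
    qed
    \<comment> \<open>At a real \<open>z\<close> the point \<open>slc J z\<close> does not depend on \<open>J\<close>, so \<open>c z = 0\<close>.\<close>
    moreover have "d z = 0" if "z \<in> {z \<in> D. z \<in> \<real>}" for z
    proof -
      from that obtain t where "z = of_real t"
        by (auto elim: Reals_cases)
      then show ?thesis
        by (simp add: d_def b_def c_def)
    qed
    ultimately have "d z = 0"
      using D z by - (rule analytic_continuation[of d D "{z \<in> D. z \<in> \<real>}" "of_real r"], auto)
    then show "cmp J u (f (slc J z)) = cmp J u (b z + J * c z)"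
      by (simp add: d_def)
  qed
  then have "\<forall>z\<in>D. sphere_pair \<Omega> f I z (b z) (c z)"
    unfolding sphere_pair_def using V sub by (intro ballI exI[of _ V]) auto
  with D stem show ?thesis
    by (intro that[of D b c]) auto
qed

section \<open>Spherical coefficients\<close>

lemma sphere_pair_exists:
  assumes "slice_domain \<Omega>" "slice_regular \<Omega> f" "I \<in> imag_units" "slc I z \<in> \<Omega>"
  obtains b c where "sphere_pair \<Omega> f I z b c"
proof -
  obtain D b c where "open D" "z \<in> D" "holomorphic_stem D b c"
    and p: "\<forall>z\<in>D. sphere_pair \<Omega> f I z (b z) (c z)"
    using local_stem[OF assms] .
  then have "sphere_pair \<Omega> f I z (b z) (c z)"
    by blast
  then show ?thesis
    by (rule that)
qed

lemma sphere_pairE: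
  assumes "sphere_pair \<Omega> f I z b c"
  obtains V where "open V" "I \<in> V"
    "\<forall>J\<in>V \<inter> imag_units. slc J z \<in> \<Omega>" "\<forall>J\<in>V \<inter> imag_units. f (slc J z) = b + J * c"
  using assms unfolding sphere_pair_def by blast

lemma sphere_pair_value:
  "sphere_pair \<Omega> f I z b c \<Longrightarrow> I \<in> imag_units \<Longrightarrow> f (slc I z) = b + I * c"
  unfolding sphere_pair_def by blast

lemma sphere_pair_mem: "sphere_pair \<Omega> f I z b c \<Longrightarrow> I \<in> imag_units \<Longrightarrow> slc I z \<in> \<Omega>"
  unfolding sphere_pair_def by blast

lemma sphere_pair_mono: "sphere_pair \<Lambda> f I z b c \<Longrightarrow> \<Lambda> \<subseteq> \<Omega> \<Longrightarrow> sphere_pair \<Omega> f I z b c"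
  unfolding sphere_pair_def subset_iff by blast

lemma sphere_pair_unique:
  assumes "sphere_pair \<Omega> f I z b c" "sphere_pair \<Omega> f I z b' c'" "I \<in> imag_units"
  shows "b = b' \<and> c = c'"
proof -
  obtain V where V: "open V" "I \<in> V"
    "\<forall>J\<in>V \<inter> imag_units. slc J z \<in> \<Omega>" "\<forall>J\<in>V \<inter> imag_units. f (slc J z) = b + J * c"
    using sphere_pairE[OF assms(1)] .
  obtain V' where V': "open V'" "I \<in> V'"
    "\<forall>J\<in>V' \<inter> imag_units. slc J z \<in> \<Omega>" "\<forall>J\<in>V' \<inter> imag_units. f (slc J z) = b' + J * c'"
    using sphere_pairE[OF assms(2)] .
  have eq: "b + J * c = b' + J * c'" if "J \<in> V \<inter> V'" "J \<in> imag_units" for J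
  proof -
    have "f (slc J z) = b + J * c" "f (slc J z) = b' + J * c'"
      using V(4) V'(4) that by blast+
    then show ?thesis by (rule trans[OF sym])
  qed
  obtain K where K: "K \<in> imag_units" "K \<in> V \<inter> V'" "K \<noteq> I"
    using imag_units_perfect[OF assms(3), of "V \<inter> V'"] V V' by blast
  have I: "b + I * c = b' + I * c'"
    using V(2) V'(2) assms(3) by (intro eq) auto
  have "(I - K) * (c - c') = (b + I * c) - (b' + I * c') - ((b + K * c) - (b' + K * c'))"
    unfolding left_diff_distrib right_diff_distrib by simp
  also have "\<dots> = 0"
    unfolding I eq[OF K(2,1)] by simp
  finally have "I - K = 0 \<or> c - c' = 0"
    by (rule mult_eq_0_iff[THEN iffD1])
  with K(3) have "c = c'"
    by simp
  with I show ?thesis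
    unfolding \<open>c = c'\<close> by simp
qed

lemma sphere_pair_uminus:
  assumes "sphere_pair \<Omega> f I z b c"
  shows "sphere_pair \<Omega> f (- I) (cnj z) b (- c)"
proof -
  obtain V where V: "open V" "I \<in> V"
    "\<forall>J\<in>V \<inter> imag_units. slc J z \<in> \<Omega>" "\<forall>J\<in>V \<inter> imag_units. f (slc J z) = b + J * c"
    using sphere_pairE[OF assms] .
  have "slc J (cnj z) \<in> \<Omega> \<and> f (slc J (cnj z)) = b + J * - c"
    if "J \<in> uminus ` V \<inter> imag_units" for J
  proof -
    from that have "- J \<in> V \<inter> imag_units"
      by (auto intro: imag_units_uminus)
    with V(3,4) show ?thesis
      by (simp add: slc_cnj)
  qed
  moreover have "open (uminus ` V)"
    using V(1) by (rule open_negations)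
  ultimately show ?thesis
    unfolding sphere_pair_def using V(2) by (intro exI[of _ "uminus ` V"]) auto
qed

text \<open>The coefficients are locally constant along the sphere.\<close>

lemma sphere_pair_nearby:
  assumes "sphere_pair \<Omega> f I z b c"
  obtains V where "open V" "I \<in> V" "\<forall>J\<in>V. sphere_pair \<Omega> f J z b c"
  using assms unfolding sphere_pair_def by blast

lemma sphere_pair_real:
  assumes "sphere_pair \<Omega> f I z b c" "I \<in> imag_units" "Im z = 0"
  shows "b = f (slc I z) \<and> c = 0"
proof -
  have "slc J z = of_real (Re z)" for J
    using assms(3) by (simp add: slc_def)
  then have "sphere_pair \<Omega> f I z (f (slc I z)) 0"
    using sphere_pair_mem[OF assms(1,2)] unfolding sphere_pair_def
    by (intro exI[of _ UNIV]) simp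
  from sphere_pair_unique[OF assms(1) this assms(2)] show ?thesis .
qed

lemma has_spherical_coeffs_iff:
  assumes I: "I \<in> imag_units" and z: "Im z > 0"
  shows "has_spherical_coeffs \<Omega> f (slc I z) b c \<longleftrightarrow> sphere_pair \<Omega> f I z b c"
proof
  have sl: "of_real (Re z) + Im z *\<^sub>R J = slc J z" for J
    by (simp add: slc_def)
  have y: "\<bar>Im z\<bar> = Im z"
    using z by simp
  note unfold = has_spherical_coeffs_def Let_def slc_sel(1)[OF I] norm_qIm_slc[OF I] y sl
  {
    assume "has_spherical_coeffs \<Omega> f (slc I z) b c"
    then obtain U where U: "openin (top_of_set (qsphere (Re z) (Im z))) U" "slc I z \<in> U" "U \<subseteq> \<Omega>"
      "\<And>J. J \<in> imag_units \<Longrightarrow> slc J z \<in> U \<Longrightarrow> f (slc J z) = b + J * c"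
      unfolding unfold by blast
    then obtain T where T: "open T" "U = qsphere (Re z) (Im z) \<inter> T"
      by (auto simp: openin_open)
    have "slc J z \<in> U" if "slc J z \<in> T" "J \<in> imag_units" for J
      using that T by (auto simp: qsphere_eq)
    moreover have "open ((\<lambda>J. slc J z) -` T)"
      by (intro open_vimage T continuous_intros)
    ultimately show "sphere_pair \<Omega> f I z b c"
      unfolding sphere_pair_def using U T by (intro exI[of _ "(\<lambda>J. slc J z) -` T"]) auto
  }
  {
    assume "sphere_pair \<Omega> f I z b c"
    then obtain V where V: "open V" "I \<in> V"
      "\<forall>J\<in>V \<inter> imag_units. slc J z \<in> \<Omega>" "\<forall>J\<in>V \<inter> imag_units. f (slc J z) = b + J * c"
      by (rule sphere_pairE)
    define k where "k q = (q - of_real (Re z)) /\<^sub>R Im z" for q :: quat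
    have k: "k (slc J z) = J" for J
      using z by (simp add: k_def slc_def)
    define U where "U = qsphere (Re z) (Im z) \<inter> k -` V"
    have "open (k -` V)"
      unfolding k_def by (intro open_vimage V continuous_intros)
    then have "openin (top_of_set (qsphere (Re z) (Im z))) U"
      unfolding U_def by (simp add: openin_open_Int)
    moreover have "slc I z \<in> U"
      using V I by (auto simp: U_def k qsphere_eq)
    moreover have "U \<subseteq> \<Omega>"
      using V by (auto simp: U_def k qsphere_eq)
    moreover have "f (slc J z) = b + J * c" if "J \<in> imag_units" "slc J z \<in> U" for J
      using that V by (auto simp: U_def k)
    ultimately show "has_spherical_coeffs \<Omega> f (slc I z) b c"
      unfolding unfold by blast
  }
qed

lemma spherical_coeffs_eq:
  assumes I: "I \<in> imag_units" and z: "Im z > 0" and p: "sphere_pair \<Omega> f I z b c"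
  shows "spherical_coeffs \<Omega> f (slc I z) = (b, c)"
  unfolding spherical_coeffs_def has_spherical_coeffs_iff[OF I z]
proof (rule the_equality)
  fix p assume "case p of (b, c) \<Rightarrow> sphere_pair \<Omega> f I z b c"
  then have "sphere_pair \<Omega> f I z (fst p) (snd p)"
    by (simp add: case_prod_unfold)
  from sphere_pair_unique[OF this \<open>sphere_pair \<Omega> f I z b c\<close> I] show "p = (b, c)"
    by (simp add: prod_eq_iff)
qed (use p in simp)

text \<open>
  For \<open>Im z < 0\<close> the point is \<open>slc (- I) (cnj z)\<close>, and both \<open>c\<close> and the imaginary part change sign;
  so the same formulas hold.
\<close>

lemma spherical_value_eq:
  assumes I: "I \<in> imag_units" and p: "sphere_pair \<Omega> f I z b c"
  shows "spherical_value \<Omega> f (slc I z) = b"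
proof -
  consider "Im z = 0" | "Im z > 0" | "Im z < 0" by linarith
  then show ?thesis
  proof cases
    case 1
    with I show ?thesis
      using sphere_pair_real[OF p I 1] by (simp add: spherical_value_def slc_in_Reals_iff)
  next
    case 2
    with I p show ?thesis
      by (simp add: spherical_value_def slc_in_Reals_iff spherical_coeffs_eq)
  next
    case 3
    have "spherical_coeffs \<Omega> f (slc (- I) (cnj z)) = (b, - c)"
      using 3 I p by (intro spherical_coeffs_eq imag_units_uminus sphere_pair_uminus) auto
    then show ?thesis
      using 3 I by (simp add: spherical_value_def slc_in_Reals_iff slc_cnj)
  qed
qed

lemma spherical_deriv_eq:
  assumes I: "I \<in> imag_units" and p: "sphere_pair \<Omega> f I z b c" and "Im z \<noteq> 0"
  shows "spherical_deriv \<Omega> f (slc I z) = c /\<^sub>R Im z"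
proof -
  consider "Im z > 0" | "Im z < 0" using assms by linarith
  then show ?thesis
  proof cases
    case 1
    with I p show ?thesis
      by (simp add: spherical_deriv_def norm_qIm_slc spherical_coeffs_eq)
  next
    case 2
    have "spherical_coeffs \<Omega> f (slc (- I) (cnj z)) = (b, - c)"
      using 2 I p by (intro spherical_coeffs_eq imag_units_uminus sphere_pair_uminus) auto
    then show ?thesis
      using 2 I by (simp add: spherical_deriv_def norm_qIm_slc slc_cnj)
  qed
qed

section \<open>The regular operations\<close>

lemma regular_prod_eq:
  assumes I: "I \<in> imag_units" and f: "sphere_pair \<Omega> f I z b c" and g: "sphere_pair \<Omega> g I z b' c'"
  shows "regular_prod \<Omega> f g (slc I z) = (b * b' - c * c') + I * (b * c' + c * b')"
proof (cases "Im z = 0")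
  case True
  then show ?thesis
    using sphere_pair_real[OF f I] sphere_pair_real[OF g I]
    by (simp add: regular_prod_def slc_in_Reals_iff I)
next
  case False
  then have one: "Im z * Im z * inverse (Im z) * inverse (Im z) = 1"
    by (simp add: field_simps)
  have "(Im z *\<^sub>R I)\<^sup>2 * (c /\<^sub>R Im z) * (c' /\<^sub>R Im z) =
      (Im z * Im z * inverse (Im z) * inverse (Im z)) *\<^sub>R (I * I * c * c')"
    by (simp only: power2_eq_square mult_scaleR_left mult_scaleR_right scaleR_scaleR mult_ac)
  then have sq: "(Im z *\<^sub>R I)\<^sup>2 * (c /\<^sub>R Im z) * (c' /\<^sub>R Im z) = - (c * c')"
    by (simp add: one imag_units_mult_self[OF I])
  have lin: "Im z *\<^sub>R I * (b * (c' /\<^sub>R Im z) + c /\<^sub>R Im z * b') = I * (b * c' + c * b')"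
    using False by (simp add: distrib_left scaleR_add_right)
  have "slc I z \<notin> \<real>"
    using False I by (simp add: slc_in_Reals_iff)
  then have "regular_prod \<Omega> f g (slc I z) = b * b' + (Im z *\<^sub>R I)\<^sup>2 * (c /\<^sub>R Im z) * (c' /\<^sub>R Im z)
      + Im z *\<^sub>R I * (b * (c' /\<^sub>R Im z) + c /\<^sub>R Im z * b')"
    unfolding regular_prod_def spherical_value_eq[OF I f] spherical_value_eq[OF I g]
      spherical_deriv_eq[OF I f False] spherical_deriv_eq[OF I g False] qIm_slc[OF I]
    by (simp only: if_False)
  then show ?thesis
    unfolding sq lin by simp
qed

lemma regular_conj_eq:
  assumes I: "I \<in> imag_units" and f: "sphere_pair \<Omega> f I z b c"
  shows "regular_conj \<Omega> f (slc I z) = qcnj b + I * qcnj c"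
proof (cases "Im z = 0")
  case True
  have "qcnj 0 = 0"
    by (simp add: quat_eq_iff)
  then show ?thesis
    using sphere_pair_real[OF f I True] by (simp add: regular_conj_def slc_in_Reals_iff I True)
next
  case False
  have "qcnj (r *\<^sub>R q) = r *\<^sub>R qcnj q" for r q
    by (simp add: quat_eq_iff)
  with False show ?thesis
    by (simp add: regular_conj_def slc_in_Reals_iff I spherical_value_eq[OF I f]
        spherical_deriv_eq[OF I f] qIm_slc)
qed

lemma symmetrization_eq:
  assumes I: "I \<in> imag_units" and f: "sphere_pair \<Omega> f I z b c"
  shows "symmetrization \<Omega> f (slc I z) = slc I (Complex ((norm b)\<^sup>2 - (norm c)\<^sup>2) (2 * inner b c))"
proof (cases "Im z = 0")
  case True
  then show ?thesis
    using sphere_pair_real[OF f I True] by (simp add: symmetrization_def slc_in_Reals_iff I slc_def)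
next
  case False
  have "norm I = 1"
    using I by (simp add: imag_units_iff)
  then have n: "norm (Im z *\<^sub>R I * (c /\<^sub>R Im z)) = norm c"
    using False by (simp add: norm_mult)
  have "qRe (b * qcnj (c /\<^sub>R Im z)) = inner b c / Im z"
    by (simp add: inner_quat_def divide_inverse algebra_simps)
  then have "2 * (Im z *\<^sub>R I) * of_real (qRe (b * qcnj (c /\<^sub>R Im z))) =
      of_real 2 * (Im z *\<^sub>R I) * of_real (inner b c / Im z)"
    by (simp only: of_real_numeral)
  also have "\<dots> = (2 * (Im z * (inner b c / Im z))) *\<^sub>R I"
    by (simp only: of_real_def mult_scaleR_left mult_scaleR_right mult_1_left mult_1_right
        scaleR_scaleR mult_ac)
  finally have lin: "2 * (Im z *\<^sub>R I) * of_real (qRe (b * qcnj (c /\<^sub>R Im z))) = (2 * inner b c) *\<^sub>R I"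
    using False by simp
  have "slc I z \<notin> \<real>"
    using False I by (simp add: slc_in_Reals_iff)
  then have "symmetrization \<Omega> f (slc I z) = of_real ((norm b)\<^sup>2)
      - of_real ((norm (Im z *\<^sub>R I * (c /\<^sub>R Im z)))\<^sup>2)
      + 2 * (Im z *\<^sub>R I) * of_real (qRe (b * qcnj (c /\<^sub>R Im z)))"
    unfolding symmetrization_def spherical_value_eq[OF I f] spherical_deriv_eq[OF I f False]
      qIm_slc[OF I]
    by (simp only: if_False)
  then show ?thesis
    unfolding lin n slc_def by simp
qed

lemma sphere_pair_prod:
  assumes "I \<in> imag_units" "sphere_pair \<Omega> f I z b c" "sphere_pair \<Omega> g I z b' c'"
  shows "sphere_pair \<Omega> (regular_prod \<Omega> f g) I z (b * b' - c * c') (b * c' + c * b')"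
proof -
  obtain V where V: "open V" "I \<in> V" "\<forall>J\<in>V. sphere_pair \<Omega> f J z b c"
    using sphere_pair_nearby[OF assms(2)] .
  obtain V' where V': "open V'" "I \<in> V'" "\<forall>J\<in>V'. sphere_pair \<Omega> g J z b' c'"
    using sphere_pair_nearby[OF assms(3)] .
  show ?thesis
    unfolding sphere_pair_def[of \<Omega> "regular_prod \<Omega> f g"]
  proof (intro exI[of _ "V \<inter> V'"] conjI ballI)
    fix J assume J: "J \<in> V \<inter> V' \<inter> imag_units"
    then have J': "J \<in> imag_units" "sphere_pair \<Omega> f J z b c" "sphere_pair \<Omega> g J z b' c'"
      using V V' by auto
    show "slc J z \<in> \<Omega>"
      by (rule sphere_pair_mem[OF J'(2,1)])
    show "regular_prod \<Omega> f g (slc J z) = (b * b' - c * c') + J * (b * c' + c * b')"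
      by (rule regular_prod_eq[OF J'])
  qed (use V V' in auto)
qed

lemma sphere_pair_conj:
  assumes "I \<in> imag_units" "sphere_pair \<Omega> f I z b c"
  shows "sphere_pair \<Omega> (regular_conj \<Omega> f) I z (qcnj b) (qcnj c)"
proof -
  obtain V where V: "open V" "I \<in> V" "\<forall>J\<in>V. sphere_pair \<Omega> f J z b c"
    using sphere_pair_nearby[OF assms(2)] .
  show ?thesis
    unfolding sphere_pair_def[of \<Omega> "regular_conj \<Omega> f"]
  proof (intro exI[of _ V] conjI ballI)
    fix J assume J: "J \<in> V \<inter> imag_units"
    then have J': "J \<in> imag_units" "sphere_pair \<Omega> f J z b c"
      using V by auto
    show "slc J z \<in> \<Omega>"
      by (rule sphere_pair_mem[OF J'(2,1)])
    show "regular_conj \<Omega> f (slc J z) = qcnj b + J * qcnj c"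
      by (rule regular_conj_eq[OF J'])
  qed (use V in auto)
qed

lemma sphere_pair_linear:
  assumes "open \<Omega>" "slc I z \<in> \<Omega>"
  shows "sphere_pair \<Omega> (\<lambda>q. q - a) I z (of_real (Re z) - a) (of_real (Im z))"
proof -
  have "open ((\<lambda>J. slc J z) -` \<Omega>)"
    by (intro open_vimage assms continuous_intros)
  then show ?thesis
    unfolding sphere_pair_def using assms
    by (intro exI[of _ "(\<lambda>J. slc J z) -` \<Omega>"]) (auto simp: slc_def of_real_def)
qed

lemma slice_regular_linear: "open \<Omega> \<Longrightarrow> slice_regular \<Omega> (\<lambda>q. q - a)"
proof (rule slice_regularI)
  fix I u assume I: "I \<in> imag_units"
  have "cmp I u (slc I z - a) = z * cmp I u 1 - cmp I u a" for z
    using cmp_slc_mult[OF I, of u z 1] linear_diff[OF bounded_linear.linear[OF bounded_linear_cmp[of I u]]]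
    by simp
  then show "(\<lambda>z. cmp I u (slc I z - a)) holomorphic_on {z. slc I z \<in> \<Omega>}"
    by (simp only:) (intro holomorphic_intros)
qed

text \<open>
  In the tensor product \<open>\<H> \<otimes>\<^sub>\<real> \<complex>\<close>, the regular product is the product and the regular conjugate is
  conjugation in the first factor; both preserve holomorphy, which gives slice regularity.
\<close>

lemma holomorphic_stem_prod:
  assumes "holomorphic_stem D b c" "holomorphic_stem D b' c'"
  shows "holomorphic_stem D (\<lambda>z. b z * b' z - c z * c' z) (\<lambda>z. b z * c' z + c z * b' z)"
  unfolding holomorphic_stem_def
proof
  fix u
  define s0 where "s0 = stem_cmp b c (Quat 1 0 0 0)"
  define s1 where "s1 = stem_cmp b c (Quat 0 1 0 0)"
  define s2 where "s2 = stem_cmp b c (Quat 0 0 1 0)"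
  define s3 where "s3 = stem_cmp b c (Quat 0 0 0 1)"
  define t0 where "t0 = stem_cmp b' c' (Quat 1 0 0 0)"
  define t1 where "t1 = stem_cmp b' c' (Quat 0 1 0 0)"
  define t2 where "t2 = stem_cmp b' c' (Quat 0 0 1 0)"
  define t3 where "t3 = stem_cmp b' c' (Quat 0 0 0 1)"
  note defs = s0_def s1_def s2_def s3_def t0_def t1_def t2_def t3_def
  have "stem_cmp (\<lambda>z. b z * b' z - c z * c' z) (\<lambda>z. b z * c' z + c z * b' z) u =
    (\<lambda>z. of_real (qRe u) * (s0 z * t0 z - s1 z * t1 z - s2 z * t2 z - s3 z * t3 z)
       + of_real (qI u) * (s0 z * t1 z + s1 z * t0 z + s2 z * t3 z - s3 z * t2 z)
       + of_real (qJ u) * (s0 z * t2 z - s1 z * t3 z + s2 z * t0 z + s3 z * t1 z)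
       + of_real (qK u) * (s0 z * t3 z + s1 z * t2 z - s2 z * t1 z + s3 z * t0 z))"
    by (rule ext) (simp add: defs stem_cmp_def inner_quat_def complex_eq_iff, simp add: algebra_simps)
  moreover have "\<dots> holomorphic_on D"
    using assms unfolding defs by (intro holomorphic_intros) (auto simp: holomorphic_stem_def)
  ultimately show "stem_cmp (\<lambda>z. b z * b' z - c z * c' z) (\<lambda>z. b z * c' z + c z * b' z) u
      holomorphic_on D"
    by (simp only:)
qed

lemma holomorphic_stem_cnj:
  assumes "holomorphic_stem D b c"
  shows "holomorphic_stem D (\<lambda>z. qcnj (b z)) (\<lambda>z. qcnj (c z))"
proof -
  have "stem_cmp (\<lambda>z. qcnj (b z)) (\<lambda>z. qcnj (c z)) u = stem_cmp b c (qcnj u)" for u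
    by (rule ext) (simp add: stem_cmp_def inner_quat_def)
  with assms show ?thesis
    by (simp add: holomorphic_stem_def)
qed

lemma slice_regularI_local_stem:
  assumes "open \<Omega>"
    and loc: "\<And>I z. I \<in> imag_units \<Longrightarrow> slc I z \<in> \<Omega> \<Longrightarrow>
      \<exists>D b c. open D \<and> z \<in> D \<and> holomorphic_stem D b c \<and> (\<forall>w\<in>D. F (slc I w) = b w + I * c w)"
  shows "slice_regular \<Omega> F"
proof (rule slice_regularI[OF assms(1)])
  fix I u assume I: "I \<in> imag_units"
  show "(\<lambda>z. cmp I u (F (slc I z))) holomorphic_on {z. slc I z \<in> \<Omega>}"
  proof (rule holomorphic_onI)
    fix z assume "z \<in> {z. slc I z \<in> \<Omega>}"
    then have "slc I z \<in> \<Omega>" by simp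
    from loc[OF I this] obtain D b c where D: "open D" "z \<in> D" "holomorphic_stem D b c"
      "\<forall>w\<in>D. F (slc I w) = b w + I * c w"
      by blast
    have "(\<lambda>w. cmp I u (F (slc I w))) holomorphic_on D"
      using holomorphic_stem_cmp[OF I D(3), of u] by (rule holomorphic_transform) (simp add: D(4))
    then have "(\<lambda>w. cmp I u (F (slc I w))) field_differentiable (at z)"
      using D(1,2) by (rule holomorphic_on_imp_differentiable_at)
    then show "(\<lambda>w. cmp I u (F (slc I w))) field_differentiable (at z within {z. slc I z \<in> \<Omega>})"
      by (rule field_differentiable_at_within)
  qed
qed

lemma slice_regular_prod:
  assumes \<Omega>: "slice_domain \<Omega>" and f: "slice_regular \<Omega> f" and g: "slice_regular \<Omega> g"
  shows "slice_regular \<Omega> (regular_prod \<Omega> f g)"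
proof (rule slice_regularI_local_stem[OF slice_domain_open[OF \<Omega>]])
  fix I z assume I: "I \<in> imag_units" and z: "slc I z \<in> \<Omega>"
  obtain D b c where D: "open D" "z \<in> D" "holomorphic_stem D b c"
    "\<forall>z\<in>D. sphere_pair \<Omega> f I z (b z) (c z)"
    using local_stem[OF \<Omega> f I z] .
  obtain D' b' c' where D': "open D'" "z \<in> D'" "holomorphic_stem D' b' c'"
    "\<forall>z\<in>D'. sphere_pair \<Omega> g I z (b' z) (c' z)"
    using local_stem[OF \<Omega> g I z] .
  have "holomorphic_stem (D \<inter> D') b c" "holomorphic_stem (D \<inter> D') b' c'"
    using D(3) D'(3) by (auto simp: holomorphic_stem_def intro: holomorphic_on_subset)
  then have stem: "holomorphic_stem (D \<inter> D') (\<lambda>z. b z * b' z - c z * c' z) (\<lambda>z. b z * c' z + c z * b' z)"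
    by (rule holomorphic_stem_prod)
  have "regular_prod \<Omega> f g (slc I w) = (b w * b' w - c w * c' w) + I * (b w * c' w + c w * b' w)"
    if w: "w \<in> D \<inter> D'" for w
    using D(4) D'(4) w by (intro regular_prod_eq I) auto
  with stem D D' show "\<exists>D b c. open D \<and> z \<in> D \<and> holomorphic_stem D b c \<and>
      (\<forall>w\<in>D. regular_prod \<Omega> f g (slc I w) = b w + I * c w)"
    by (intro exI[of _ "D \<inter> D'"] exI[of _ "\<lambda>z. b z * b' z - c z * c' z"]
        exI[of _ "\<lambda>z. b z * c' z + c z * b' z"]) auto
qed

lemma slice_regular_conj:
  assumes \<Omega>: "slice_domain \<Omega>" and f: "slice_regular \<Omega> f"
  shows "slice_regular \<Omega> (regular_conj \<Omega> f)"
proof (rule slice_regularI_local_stem[OF slice_domain_open[OF \<Omega>]])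
  fix I z assume I: "I \<in> imag_units" and z: "slc I z \<in> \<Omega>"
  obtain D b c where D: "open D" "z \<in> D" "holomorphic_stem D b c"
    "\<forall>z\<in>D. sphere_pair \<Omega> f I z (b z) (c z)"
    using local_stem[OF \<Omega> f I z] .
  have "regular_conj \<Omega> f (slc I w) = qcnj (b w) + I * qcnj (c w)" if w: "w \<in> D" for w
    using D(4) w by (intro regular_conj_eq I) auto
  with D holomorphic_stem_cnj[OF D(3)] show "\<exists>D b c. open D \<and> z \<in> D \<and> holomorphic_stem D b c \<and>
      (\<forall>w\<in>D. regular_conj \<Omega> f (slc I w) = b w + I * c w)"
    by (intro exI[of _ D] exI[of _ "\<lambda>z. qcnj (b z)"] exI[of _ "\<lambda>z. qcnj (c z)"]) auto
qed

section \<open>Division by slice-preserving functions\<close>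

lemma slc_inverse:
  assumes "I \<in> imag_units"
  shows "slc I (inverse z) = inverse (slc I z)"
proof (cases "z = 0")
  case False
  then have "slc I z * slc I (inverse z) = slc I 1"
    by (simp add: slc_mult[OF assms, symmetric])
  also have "slc I 1 = 1"
    using slc_of_real[of I 1] by simp
  finally show ?thesis
    by (rule inverse_unique[symmetric])
qed (simp add: slc_def)

lemma cmp_vector_derivative:
  assumes I: "I \<in> imag_units" and "open \<Omega>" "slice_regular \<Omega> F" "slc I w \<in> \<Omega>"
  shows "cmp I u (vector_derivative (\<lambda>t. F (slc I w + of_real t)) (at 0)) =
    deriv (\<lambda>z. cmp I u (F (slc I z))) w"
proof -
  have "w \<in> {z. slc I z \<in> \<Omega>}"
    using assms by simp
  from cmp_holomorphic_has_derivative[OF I open_vimage_slc[OF assms(2)] this slice_regularD[OF assms(2,3) I]]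
  obtain v where v: "((\<lambda>z. F (slc I z)) has_derivative (\<lambda>h. slc I h * v)) (at w)"
    and d: "\<And>u. deriv (\<lambda>z. cmp I u (F (slc I z))) w = cmp I u v"
    by metis
  have "((\<lambda>t. w + of_real t) has_derivative (\<lambda>h. of_real h)) (at (0::real))"
    by (auto intro!: derivative_eq_intros)
  from has_derivative_compose[OF this, of "\<lambda>z. F (slc I z)" "\<lambda>h. slc I h * v"] v
  have "((\<lambda>t. F (slc I (w + of_real t))) has_derivative (\<lambda>h. slc I (of_real h) * v)) (at 0)"
    by simp
  then have "((\<lambda>t. F (slc I w + of_real t)) has_vector_derivative v) (at 0)"
    by (simp add: slc_add has_vector_derivative_def scaleR_conv_of_real)
  then show ?thesis
    by (simp add: d vector_derivative_at)
qed

text \<open>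
  Let \<open>N\<close> act on every slice as the same holomorphic function \<open>n\<close>, with simple zeros,
  and let \<open>N'\<close> act as the derivative \<open>n'\<close>. A slice
  regular function that vanishes where \<open>N\<close> does is divisible by \<open>N\<close>. At a zero of \<open>N\<close> the value
  of the quotient is \<open>N'\<^sup>-\<^sup>1 F'\<close>, where \<open>F'\<close> is the derivative in the real direction; it does not
  depend on the slice.
\<close>

lemma slice_regular_divide:
  assumes \<Lambda>: "open \<Lambda>" and F: "slice_regular \<Lambda> F"
    and N: "\<And>I z. I \<in> imag_units \<Longrightarrow> N (slc I z) = slc I (n z)"
    and N': "\<And>I z. I \<in> imag_units \<Longrightarrow> N' (slc I z) = slc I (n' z)"
    and n': "\<And>z. (n has_field_derivative n' z) (at z)"
    and simple: "\<And>z. n z = 0 \<Longrightarrow> n' z \<noteq> 0"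
    and vanish: "\<And>q. q \<in> \<Lambda> \<Longrightarrow> N q = 0 \<Longrightarrow> F q = 0"
  obtains h where "slice_regular \<Lambda> h" "\<forall>q\<in>\<Lambda>. F q = N q * h q"
proof -
  define h where "h q = (if N q = 0
    then inverse (N' q) * vector_derivative (\<lambda>t. F (q + of_real t)) (at 0)
    else inverse (N q) * F q)" for q
  have "slice_regular \<Lambda> h"
  proof (rule slice_regularI[OF \<Lambda>])
    fix I u assume I: "I \<in> imag_units"
    define D where "D = {z. slc I z \<in> \<Lambda>}"
    have D: "open D"
      unfolding D_def using \<Lambda> by (rule open_vimage_slc)
    define \<phi> where "\<phi> z = cmp I u (F (slc I z))" for z
    have \<phi>: "\<phi> holomorphic_on D"
      unfolding \<phi>_def D_def using \<Lambda> F I by (rule slice_regularD)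
    have hn: "n holomorphic_on UNIV"
      unfolding holomorphic_on_open[OF open_UNIV] using n' by blast
    have N0: "N (slc I z) = 0 \<longleftrightarrow> n z = 0" for z
      by (simp add: N[OF I] slc_eq_0[OF I])
    have h1: "cmp I u (h (slc I z)) = \<phi> z / n z" if "n z \<noteq> 0" for z
    proof -
      have "h (slc I z) = slc I (inverse (n z)) * F (slc I z)"
        using that unfolding h_def N0 by (simp add: N[OF I] slc_inverse[OF I])
      then show ?thesis
        by (simp add: cmp_slc_mult[OF I] \<phi>_def divide_inverse mult.commute)
    qed
    have h2: "cmp I u (h (slc I z)) = deriv \<phi> z / n' z" if "n z = 0" "z \<in> D" for z
    proof -
      have "h (slc I z) = slc I (inverse (n' z)) * vector_derivative (\<lambda>t. F (slc I z + of_real t)) (at 0)"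
        using that unfolding h_def N0 by (simp add: N'[OF I] slc_inverse[OF I])
      moreover have "cmp I u (vector_derivative (\<lambda>t. F (slc I z + of_real t)) (at 0)) = deriv \<phi> z"
        unfolding \<phi>_def using that(2) by (intro cmp_vector_derivative[OF I \<Lambda> F]) (simp add: D_def)
      ultimately show ?thesis
        by (simp add: cmp_slc_mult[OF I] divide_inverse mult.commute)
    qed
    have "(\<lambda>z. cmp I u (h (slc I z))) field_differentiable (at w)" if w: "w \<in> D" for w
    proof (cases "n w = 0")
      case False
      define U where "U = D \<inter> n -` (- {0})"
      have "open U"
        unfolding U_def using D hn
        by (intro open_Int open_vimage holomorphic_on_imp_continuous_on) auto
      have "(\<lambda>z. \<phi> z / n z) holomorphic_on U"
        by (intro holomorphic_intros holomorphic_on_subset[OF \<phi>] holomorphic_on_subset[OF hn])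
           (auto simp: U_def)
      then have "(\<lambda>z. cmp I u (h (slc I z))) holomorphic_on U"
        by (rule holomorphic_transform) (simp add: U_def h1)
      then show ?thesis
        using \<open>open U\<close> by (rule holomorphic_on_imp_differentiable_at) (use False w in \<open>simp add: U_def\<close>)
    next
      case True
      \<comment> \<open>Both \<open>\<phi>\<close> and \<open>n\<close> vanish at \<open>w\<close>; near \<open>w\<close> the quotient \<open>\<phi> / n\<close> extends as the quotient of
        their difference quotients.\<close>
      define \<phi>1 where "\<phi>1 z = (if z = w then deriv \<phi> w else (\<phi> z - \<phi> w) / (z - w))" for z
      define n1 where "n1 z = (if z = w then deriv n w else (n z - n w) / (z - w))" for z
      have \<phi>1: "\<phi>1 holomorphic_on D"
        unfolding \<phi>1_def using \<phi> w D by (intro pole_lemma) (simp_all add: interior_open)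
      have n1: "n1 holomorphic_on UNIV"
        unfolding n1_def using hn by (intro pole_lemma) simp_all
      have n1w: "n1 w = n' w"
        using DERIV_imp_deriv[OF n'] by (simp add: n1_def)
      have \<phi>w: "\<phi> w = 0"
        using vanish[of "slc I w"] True w N0[of w] by (simp add: \<phi>_def D_def cmp_def complex_eq_iff)
      define U where "U = D \<inter> n1 -` (- {0})"
      have "open U"
        unfolding U_def using D n1
        by (intro open_Int open_vimage holomorphic_on_imp_continuous_on) auto
      have "(\<lambda>z. \<phi>1 z / n1 z) holomorphic_on U"
        by (intro holomorphic_intros holomorphic_on_subset[OF \<phi>1] holomorphic_on_subset[OF n1])
           (auto simp: U_def)
      then have "(\<lambda>z. cmp I u (h (slc I z))) holomorphic_on U"
      proof (rule holomorphic_transform)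
        fix z assume z: "z \<in> U"
        show "\<phi>1 z / n1 z = cmp I u (h (slc I z))"
        proof (cases "z = w")
          case True
          then show ?thesis
            using h2[OF \<open>n w = 0\<close> w] n1w by (simp add: \<phi>1_def)
        next
          case False
          have n1z: "n1 z = n z / (z - w)"
            using False \<open>n w = 0\<close> by (simp add: n1_def)
          then have "n z \<noteq> 0"
            using z by (auto simp: U_def)
          from h1[OF this] show ?thesis
            using False by (simp add: n1z \<phi>1_def \<phi>w)
        qed
      qed
      then show ?thesis
        using \<open>open U\<close>
        by (rule holomorphic_on_imp_differentiable_at) (use w n1w simple[OF True] in \<open>simp add: U_def\<close>)
    qed
    then show "(\<lambda>z. cmp I u (h (slc I z))) holomorphic_on {z. slc I z \<in> \<Lambda>}"
      unfolding D_def[symmetric] holomorphic_on_def by (blast intro: field_differentiable_at_within)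
  qed
  moreover have "\<forall>q\<in>\<Lambda>. F q = N q * h q"
  proof
    fix q assume "q \<in> \<Lambda>"
    then show "F q = N q * h q"
    proof (cases "N q = 0")
      case True
      with vanish[OF \<open>q \<in> \<Lambda>\<close>] show ?thesis by simp
    next
      case False
      then have "h q = inverse (N q) * F q"
        by (simp only: h_def if_False)
      then show ?thesis
        by (simp only: mult_inverse_cancel[OF False])
    qed
  qed
  ultimately show ?thesis
    by (rule that)
qed

lemma sphere_pair_cong:
  assumes "sphere_pair \<Omega> f I z b c" "\<forall>q\<in>\<Omega>. f q = g q"
  shows "sphere_pair \<Omega> g I z b c"
proof -
  obtain V where "open V" "I \<in> V"
    "\<forall>J\<in>V \<inter> imag_units. slc J z \<in> \<Omega>" "\<forall>J\<in>V \<inter> imag_units. f (slc J z) = b + J * c"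
    using sphere_pairE[OF assms(1)] .
  with assms(2) show ?thesis
    unfolding sphere_pair_def by (intro exI[of _ V]) auto
qed

lemma slc_mult_coeffs:
  assumes "J \<in> imag_units"
  shows "slc J w * (b + J * c) =
    (Re w *\<^sub>R b - Im w *\<^sub>R c) + J * (Re w *\<^sub>R c + Im w *\<^sub>R b)"
  using imag_units_mult_self'[OF assms, of c]
  by (simp add: slc_def of_real_def distrib_left distrib_right scaleR_add_right)

lemma sphere_pair_slice_preserving_mult:
  assumes h: "sphere_pair \<Omega> h I z b c"
    and N: "\<And>J. J \<in> imag_units \<Longrightarrow> N (slc J z) = slc J w"
  shows "sphere_pair \<Omega> (\<lambda>q. N q * h q) I z (Re w *\<^sub>R b - Im w *\<^sub>R c) (Re w *\<^sub>R c + Im w *\<^sub>R b)"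
proof -
  obtain V where V: "open V" "I \<in> V"
    "\<forall>J\<in>V \<inter> imag_units. slc J z \<in> \<Omega>" "\<forall>J\<in>V \<inter> imag_units. h (slc J z) = b + J * c"
    using sphere_pairE[OF h] .
  show ?thesis
    unfolding sphere_pair_def
  proof (intro exI[of _ V] conjI ballI)
    fix J assume J: "J \<in> V \<inter> imag_units"
    then show "slc J z \<in> \<Omega>"
      using V by blast
    have "J \<in> imag_units" "h (slc J z) = b + J * c"
      using J V by auto
    then show "N (slc J z) * h (slc J z) =
        (Re w *\<^sub>R b - Im w *\<^sub>R c) + J * (Re w *\<^sub>R c + Im w *\<^sub>R b)"
      by (simp only: N slc_mult_coeffs)
  qed (use V in auto)
qed

section \<open>Divisibility by a linear factor\<close>

lemma connected_image_slc:
  assumes "connected {z. slc I z \<in> T}"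
  shows "connected (T \<inter> slice_plane I)"
proof -
  have "T \<inter> slice_plane I = slc I ` {z. slc I z \<in> T}"
    by (auto simp: slice_plane_eq)
  then show ?thesis
    using assms by (auto intro!: connected_continuous_image continuous_intros)
qed

text \<open>
  A slice meets a sphere off the real axis in two points, and removing them does not disconnect a
  domain of the slice.
\<close>

lemma slice_domain_diff:
  assumes \<Omega>: "slice_domain \<Omega>" and z0: "Im z0 > 0" and B: "B \<subseteq> qsphere (Re z0) (Im z0)"
    and op: "open (\<Omega> - B)"
  shows "slice_domain (\<Omega> - B)"
proof -
  obtain r where r: "of_real r \<in> \<Omega>"
    using slice_domain_real[OF \<Omega>] .
  have "of_real r \<noteq> slc I z0" if "I \<in> imag_units" for I
  proof
    assume "of_real r = slc I z0"
    then have "slc I z0 \<in> \<real>"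
      by (metis Reals_of_real)
    then show False
      using slc_in_Reals_iff[OF that, of z0] z0 by simp
  qed
  then have r': "of_real r \<in> \<Omega> - B"
    using r B by (auto simp: qsphere_eq)
  have conn: "connected ((\<Omega> - B) \<inter> slice_plane I)" if I: "I \<in> imag_units" for I
  proof -
    define T where "T = {z. slc I z \<in> B}"
    have "T \<subseteq> {z0, cnj z0}"
    proof
      fix z assume "z \<in> T"
      then obtain J where J: "J \<in> imag_units" "slc I z = slc J z0"
        using B by (auto simp: T_def qsphere_eq)
      then have e: "Re z = Re z0" "Im z *\<^sub>R I = Im z0 *\<^sub>R J"
        using slc_eq_iff[OF I J(1)] by auto
      have "\<bar>Im z\<bar> = \<bar>Im z0\<bar>"
        using arg_cong[OF e(2), of norm] I J(1) by (simp add: imag_units_iff)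
      with e(1) show "z \<in> {z0, cnj z0}"
        by (auto simp: complex_eq_iff abs_eq_iff)
    qed
    then have "finite T"
      by (rule finite_subset) simp
    then have "connected ({z. slc I z \<in> \<Omega>} - T)"
      using slice_domain_connected[OF \<Omega> I] open_vimage_slc[OF slice_domain_open[OF \<Omega>]]
      by (intro connected_open_delete_finite) auto
    moreover have "{z. slc I z \<in> \<Omega>} - T = {z. slc I z \<in> \<Omega> - B}"
      by (auto simp: T_def)
    ultimately show ?thesis
      by (intro connected_image_slc) simp
  qed
  have rI: "of_real r \<in> slice_plane I" for I
    unfolding slice_plane_eq by (rule range_eqI[of _ _ "of_real r"]) simp
  have "\<Omega> - B = (\<Union>I\<in>imag_units. (\<Omega> - B) \<inter> slice_plane I)"
  proof (intro equalityI subsetI)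
    fix q assume q: "q \<in> \<Omega> - B"
    obtain I z where "I \<in> imag_units" "0 \<le> Im z" "q = slc I z"
      using slc_surj[of q] .
    with q show "q \<in> (\<Union>I\<in>imag_units. (\<Omega> - B) \<inter> slice_plane I)"
      by (auto simp: slice_plane_eq)
  qed auto
  moreover have "connected (\<Union>I\<in>imag_units. (\<Omega> - B) \<inter> slice_plane I)"
  proof (rule connected_Union)
    show "\<Inter> ((\<lambda>I. (\<Omega> - B) \<inter> slice_plane I) ` imag_units) \<noteq> {}"
      using r' rI by auto
  qed (use conn in auto)
  ultimately have "connected (\<Omega> - B)"
    by simp
  moreover have "openin (top_of_set (slice_plane I)) ((\<Omega> - B) \<inter> slice_plane I)" for I
    using openin_open_Int[OF op, of "slice_plane I"] by (simp add: Int_commute)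
  ultimately show ?thesis
    unfolding slice_domain_def domain_of_def using conn op r' rI
    by auto
qed

lemma open_sphere_direction:
  assumes "open V" "Im z0 > 0"
  shows "open {q :: quat. (q - of_real (Re z0)) /\<^sub>R Im z0 \<in> V}"
proof -
  have "open ((\<lambda>q :: quat. (q - of_real (Re z0)) /\<^sub>R Im z0) -` V)"
    by (intro open_vimage assms continuous_intros)
  then show ?thesis
    by (simp add: vimage_def)
qed

lemma sphere_direction_slc:
  "Im z0 > 0 \<Longrightarrow> (slc J z0 - of_real (Re z0)) /\<^sub>R Im z0 = J"
  by (simp add: slc_def)

text \<open>
  The coefficients are constant on a connected part of the sphere, since they are locally constant
  there. On a real point, \<open>b\<close> is the value of \<open>f\<close> and \<open>c = 0\<close>.
\<close>

lemma sphere_pair_constant: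
  assumes \<Omega>: "slice_domain \<Omega>" and f: "slice_regular \<Omega> f" and z0: "Im z0 \<ge> 0"
    and C: "connected C" "C \<subseteq> qsphere (Re z0) (Im z0) \<inter> \<Omega>"
  obtains b c where "\<forall>J\<in>imag_units. slc J z0 \<in> C \<longrightarrow> sphere_pair \<Omega> f J z0 b c"
proof (cases "Im z0 = 0")
  case True
  have eq: "slc J z0 = of_real (Re z0)" for J
    using True by (simp add: slc_def)
  have "sphere_pair \<Omega> f J z0 (f (of_real (Re z0))) 0" if J: "J \<in> imag_units" "slc J z0 \<in> C" for J
  proof -
    have "slc J z0 \<in> \<Omega>"
      using J C by blast
    then obtain b c where p: "sphere_pair \<Omega> f J z0 b c"
      using sphere_pair_exists[OF \<Omega> f J(1)] by metis
    from sphere_pair_real[OF this J(1) True] have "b = f (of_real (Re z0))" "c = 0"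
      unfolding eq by simp_all
    with p show ?thesis by (simp only:)
  qed
  then show ?thesis
    using that by blast
next
  case False
  with z0 have y: "Im z0 > 0" by simp
  have repr: "\<exists>J\<in>imag_units. q = slc J z0" if "q \<in> C" for q
    using that C by (auto simp: qsphere_eq)
  have coeffs: "sphere_pair \<Omega> f J z0 (fst (spherical_coeffs \<Omega> f (slc J z0)))
      (snd (spherical_coeffs \<Omega> f (slc J z0)))" if J: "J \<in> imag_units" "slc J z0 \<in> C" for J
  proof -
    have "slc J z0 \<in> \<Omega>"
      using J C by blast
    then obtain b c where p: "sphere_pair \<Omega> f J z0 b c"
      using sphere_pair_exists[OF \<Omega> f J(1)] by metis
    show ?thesis
      unfolding spherical_coeffs_eq[OF J(1) y p] using p by simp
  qed
  have const: "spherical_coeffs \<Omega> f p = spherical_coeffs \<Omega> f q" if pq: "p \<in> C" "q \<in> C" for p q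
  proof (rule connected_local_const[OF C(1) pq], rule ballI)
    fix a assume a: "a \<in> C"
    then obtain J where J: "J \<in> imag_units" "a = slc J z0"
      using repr by blast
    have p: "sphere_pair \<Omega> f J z0 (fst (spherical_coeffs \<Omega> f a)) (snd (spherical_coeffs \<Omega> f a))"
      unfolding J(2) using J a by (intro coeffs) auto
    obtain V where V: "open V" "J \<in> V"
      "\<forall>K\<in>V. sphere_pair \<Omega> f K z0 (fst (spherical_coeffs \<Omega> f a)) (snd (spherical_coeffs \<Omega> f a))"
      using sphere_pair_nearby[OF p] .
    let ?U = "{q. (q - of_real (Re z0)) /\<^sub>R Im z0 \<in> V}"
    have U: "open ?U" "a \<in> ?U"
      using open_sphere_direction[OF V(1) y] V(2) by (simp_all add: J(2) sphere_direction_slc[OF y])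
    have "spherical_coeffs \<Omega> f a = spherical_coeffs \<Omega> f x" if x: "x \<in> ?U" "x \<in> C" for x
    proof -
      obtain K where K: "K \<in> imag_units" "x = slc K z0"
        using repr x(2) by blast
      have "K \<in> V"
        using x(1) by (simp add: K(2) sphere_direction_slc[OF y])
      with V(3) have "sphere_pair \<Omega> f K z0 (fst (spherical_coeffs \<Omega> f a)) (snd (spherical_coeffs \<Omega> f a))"
        by blast
      from spherical_coeffs_eq[OF K(1) y this] show ?thesis
        by (simp add: K(2))
    qed
    then show "\<forall>\<^sub>F x in at a within C. spherical_coeffs \<Omega> f a = spherical_coeffs \<Omega> f x"
      unfolding eventually_at_topological using U by blast
  qed
  show ?thesis
  proof (cases "C = {}")
    case True
    then show ?thesis using that by blast
  next
    case False
    then obtain a where a: "a \<in> C" by blast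
    have "sphere_pair \<Omega> f J z0 (fst (spherical_coeffs \<Omega> f a)) (snd (spherical_coeffs \<Omega> f a))"
      if J: "J \<in> imag_units" "slc J z0 \<in> C" for J
      using coeffs[OF J] unfolding const[OF J(2) a] .
    then show ?thesis
      using that by blast
  qed
qed

lemma divides_near_imp:
  assumes div: "divides_near \<Omega> (slc I' z0) g C" and I: "I \<in> imag_units" "slc I z0 \<in> C"
    and I': "I' \<in> imag_units" and g: "sphere_pair \<Omega> g I z0 b c"
  shows "b + I' * c = 0"
proof -
  obtain \<Lambda> h where \<Lambda>: "slice_domain \<Lambda>" "C \<subseteq> \<Lambda>" "\<Lambda> \<subseteq> \<Omega>" and h: "slice_regular \<Lambda> h"
    and eq: "\<forall>q\<in>\<Lambda>. g q = regular_prod \<Lambda> (\<lambda>q. q - slc I' z0) h q"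
    using div unfolding divides_near_def by blast
  have m: "slc I z0 \<in> \<Lambda>"
    using I(2) \<Lambda>(2) by blast
  obtain \<beta> \<gamma> where p: "sphere_pair \<Lambda> h I z0 \<beta> \<gamma>"
    using sphere_pair_exists[OF \<Lambda>(1) h I(1) m] .
  define a where "a = of_real (Re z0) - slc I' z0"
  have a: "a = - (Im z0 *\<^sub>R I')"
    by (simp add: a_def slc_def)
  have "sphere_pair \<Lambda> (\<lambda>q. q - slc I' z0) I z0 a (of_real (Im z0))"
    unfolding a_def using slice_domain_open[OF \<Lambda>(1)] m by (rule sphere_pair_linear)
  from sphere_pair_prod[OF I(1) this p]
  have "sphere_pair \<Lambda> (regular_prod \<Lambda> (\<lambda>q. q - slc I' z0) h) I z0
      (a * \<beta> - of_real (Im z0) * \<gamma>) (a * \<gamma> + of_real (Im z0) * \<beta>)" .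
  then have "sphere_pair \<Lambda> g I z0 (a * \<beta> - of_real (Im z0) * \<gamma>) (a * \<gamma> + of_real (Im z0) * \<beta>)"
    by (rule sphere_pair_cong) (simp add: eq)
  from sphere_pair_unique[OF sphere_pair_mono[OF this \<Lambda>(3)] g I(1)]
  have "b = a * \<beta> - of_real (Im z0) * \<gamma>" "c = a * \<gamma> + of_real (Im z0) * \<beta>"
    by auto
  then show ?thesis
    using imag_units_mult_self'[OF I', of \<gamma>]
    by (simp add: a of_real_def distrib_left right_diff_distrib)
qed

lemma divides_near_real:
  assumes \<Omega>: "slice_domain \<Omega>" and g: "slice_regular \<Omega> g" and "C \<subseteq> \<Omega>" and g0: "g (of_real x) = 0"
  shows "divides_near \<Omega> (of_real x) g C"
proof -
  have op: "open \<Omega>"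
    using \<Omega> by (rule slice_domain_open)
  obtain h where h: "slice_regular \<Omega> h" "\<forall>q\<in>\<Omega>. g q = (q - of_real x) * h q"
  proof (rule slice_regular_divide[OF op g])
    show "slc I z - of_real x = slc I (z - of_real x)" for I z
      by (simp add: slc_diff)
    show "(1 :: quat) = slc I 1" for I
      using slc_of_real[of I 1] by simp
    show "((\<lambda>z. z - complex_of_real x) has_field_derivative 1) (at z)" for z
      by (auto intro!: derivative_eq_intros)
  qed (use g0 in auto)
  have "g q = regular_prod \<Omega> (\<lambda>q. q - of_real x) h q" if q: "q \<in> \<Omega>" for q
  proof -
    obtain I z where I: "I \<in> imag_units" "0 \<le> Im z" "q = slc I z"
      using slc_surj[of q] .
    then have m: "slc I z \<in> \<Omega>"
      using q by simp
    obtain \<beta> \<gamma> where p: "sphere_pair \<Omega> h I z \<beta> \<gamma>"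
      using sphere_pair_exists[OF \<Omega> h(1) I(1) m] .
    have "regular_prod \<Omega> (\<lambda>q. q - of_real x) h (slc I z) =
      (of_real (Re z) - of_real x) * \<beta> - of_real (Im z) * \<gamma> +
      I * ((of_real (Re z) - of_real x) * \<gamma> + of_real (Im z) * \<beta>)"
      by (rule regular_prod_eq[OF I(1) sphere_pair_linear[OF op m] p])
    also have "\<dots> = (slc I z - of_real x) * (\<beta> + I * \<gamma>)"
      using imag_units_mult_self'[OF I(1), of \<gamma>]
      by (simp add: slc_def of_real_def distrib_left distrib_right left_diff_distrib right_diff_distrib
          scaleR_add_right)
    also have "\<beta> + I * \<gamma> = h (slc I z)"
      using sphere_pair_value[OF p I(1)] by simp
    finally show ?thesis
      using h(2) q by (simp add: I(3))
  qed
  then show ?thesis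
    unfolding divides_near_def using \<Omega> h(1) \<open>C \<subseteq> \<Omega>\<close>
    by (intro exI[of _ \<Omega>] exI[of _ h]) auto
qed

text \<open>
  The construction of the quotient when the sphere is not a real point. Since \<open>\<Omega>\<close> need not be
  symmetric, the coefficients of \<open>g\<close> may differ between the parts of the sphere; the slice domain
  \<open>\<Lambda>\<close> is obtained by removing those points of the sphere where \<open>b + I' c \<noteq> 0\<close>.
\<close>

lemma divides_near_sphere:
  assumes \<Omega>: "slice_domain \<Omega>" and g: "slice_regular \<Omega> g" and I': "I' \<in> imag_units"
    and y: "Im z0 > 0" and C: "C \<subseteq> qsphere (Re z0) (Im z0) \<inter> \<Omega>"
    and pair: "\<forall>J\<in>imag_units. slc J z0 \<in> C \<longrightarrow> sphere_pair \<Omega> g J z0 b c"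
    and bc: "b + I' * c = 0"
  shows "divides_near \<Omega> (slc I' z0) g C"
proof -
  \<comment> \<open>The points of the sphere where the condition on the coefficients fails. This set is
    closed in \<open>\<Omega>\<close> because the coefficients are locally constant on the sphere, and it misses \<open>C\<close>.\<close>
  define B where "B = {slc J z0 | J b c. J \<in> imag_units \<and> sphere_pair \<Omega> g J z0 b c \<and> b + I' * c \<noteq> 0}"
  define \<Lambda> where "\<Lambda> = \<Omega> - B"
  have BS: "B \<subseteq> qsphere (Re z0) (Im z0)"
    unfolding B_def qsphere_eq by blast
  have good: "b + I' * c = 0" if "J \<in> imag_units" "slc J z0 \<in> \<Lambda>" "sphere_pair \<Omega> g J z0 b c" for J b c
  proof (rule ccontr)
    assume "b + I' * c \<noteq> 0"
    with that(1,3) have "slc J z0 \<in> B"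
      unfolding B_def by blast
    with that(2) show False
      by (simp add: \<Lambda>_def)
  qed
  have notB: "slc J z0 \<notin> B" if J: "J \<in> imag_units" "sphere_pair \<Omega> g J z0 b c" "b + I' * c = 0" for J b c
  proof
    assume "slc J z0 \<in> B"
    then obtain K b' c' where K: "slc J z0 = slc K z0" "K \<in> imag_units"
      "sphere_pair \<Omega> g K z0 b' c'" "b' + I' * c' \<noteq> 0"
      unfolding B_def by blast
    have "K = J"
      by (rule trans[OF sphere_direction_slc[OF y, of K, symmetric]
            sphere_direction_slc[OF y, of J, unfolded K(1)]])
    from K(3) have "sphere_pair \<Omega> g J z0 b' c'"
      unfolding \<open>K = J\<close> .
    from sphere_pair_unique[OF J(2) this J(1)] have "b' + I' * c' = b + I' * c"
      by simp
    with J(3) K(4) show False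
      by simp
  qed
  have op: "open \<Lambda>"
  proof (subst open_subopen, rule ballI)
    fix q assume q: "q \<in> \<Lambda>"
    show "\<exists>T. open T \<and> q \<in> T \<and> T \<subseteq> \<Lambda>"
    proof (cases "q \<in> qsphere (Re z0) (Im z0)")
      case False
      have "open (\<Omega> - qsphere (Re z0) (Im z0))"
        using slice_domain_open[OF \<Omega>] closed_qsphere by (rule open_Diff)
      then show ?thesis
        using False q BS by (intro exI[of _ "\<Omega> - qsphere (Re z0) (Im z0)"]) (auto simp: \<Lambda>_def)
    next
      case True
      then obtain J where J: "J \<in> imag_units" "q = slc J z0"
        by (auto simp: qsphere_eq)
      have "slc J z0 \<in> \<Omega>"
        using q J by (simp add: \<Lambda>_def)
      then obtain b c where p: "sphere_pair \<Omega> g J z0 b c"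
        using sphere_pair_exists[OF \<Omega> g J(1)] by metis
      have z: "b + I' * c = 0"
        by (rule good[OF J(1) _ p]) (use q J in simp)
      obtain V where V: "open V" "J \<in> V" "\<forall>K\<in>V. sphere_pair \<Omega> g K z0 b c"
        using sphere_pair_nearby[OF p] .
      let ?U = "{q. (q - of_real (Re z0)) /\<^sub>R Im z0 \<in> V}"
      have "?U \<inter> \<Omega> \<subseteq> \<Lambda>"
      proof
        fix x assume x: "x \<in> ?U \<inter> \<Omega>"
        show "x \<in> \<Lambda>"
        proof (cases "x \<in> B")
          case True
          then obtain K where K: "K \<in> imag_units" "x = slc K z0"
            using BS by (auto simp: qsphere_eq)
          have "K \<in> V"
            using x by (simp add: K(2) sphere_direction_slc[OF y])
          with V(3) have "sphere_pair \<Omega> g K z0 b c" by blast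
          from notB[OF K(1) this z] True K(2) show ?thesis by simp
        qed (use x in \<open>simp add: \<Lambda>_def\<close>)
      qed
      moreover have "open (?U \<inter> \<Omega>)"
        using open_sphere_direction[OF V(1) y] slice_domain_open[OF \<Omega>] by (rule open_Int)
      moreover have "q \<in> ?U \<inter> \<Omega>"
        using V(2) \<open>slc J z0 \<in> \<Omega>\<close> by (simp add: J(2) sphere_direction_slc[OF y])
      ultimately show ?thesis by blast
    qed
  qed
  have \<Lambda>: "slice_domain \<Lambda>"
    unfolding \<Lambda>_def using slice_domain_diff[OF \<Omega> y BS] op by (simp add: \<Lambda>_def)
  have sub: "\<Lambda> \<subseteq> \<Omega>"
    by (auto simp: \<Lambda>_def)
  have CL: "C \<subseteq> \<Lambda>"
  proof
    fix q assume q: "q \<in> C"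
    then obtain J where J: "J \<in> imag_units" "q = slc J z0"
      using C by (auto simp: qsphere_eq)
    then have "sphere_pair \<Omega> g J z0 b c"
      using pair q by blast
    from notB[OF J(1) this bc] q C show "q \<in> \<Lambda>"
      by (auto simp: \<Lambda>_def J(2))
  qed
  have g': "slice_regular \<Lambda> g"
    by (rule slice_regular_subset[OF slice_domain_open[OF \<Omega>] g op sub])
  \<comment> \<open>The conjugate of the root: the regular product of the two linear factors is the real
    polynomial \<open>N\<close> below, so the wanted quotient is \<open>N\<^sup>-\<^sup>1 F\<close>.\<close>
  define p' where "p' = slc (- I') z0"
  have p': "of_real (Re z0) - p' = Im z0 *\<^sub>R I'"
    by (simp add: p'_def slc_def)
  define F where "F = regular_prod \<Lambda> (\<lambda>q. q - p') g"
  have F: "slice_regular \<Lambda> F"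
    unfolding F_def by (rule slice_regular_prod[OF \<Lambda> slice_regular_linear[OF op] g'])
  have Fpair: "sphere_pair \<Lambda> F J z ((of_real (Re z) - p') * b - of_real (Im z) * c)
      ((of_real (Re z) - p') * c + of_real (Im z) * b)"
    if "J \<in> imag_units" "sphere_pair \<Lambda> g J z b c" for J z b c
    unfolding F_def
    by (rule sphere_pair_prod[OF that(1) sphere_pair_linear[OF op sphere_pair_mem[OF that(2,1)]] that(2)])
  define N where "N q = q * q - (2 * Re z0) *\<^sub>R q + of_real ((Re z0)\<^sup>2 + (Im z0)\<^sup>2)" for q :: quat
  define n where "n z = (z - z0) * (z - cnj z0)" for z
  have n_eq: "n z = z * z - of_real (2 * Re z0) * z + of_real ((Re z0)\<^sup>2 + (Im z0)\<^sup>2)" for z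
    by (simp add: n_def complex_eq_iff power2_eq_square algebra_simps)
  have N: "N (slc J z) = slc J (n z)" if "J \<in> imag_units" for J z
    by (simp only: n_eq N_def slc_add slc_diff slc_mult[OF that] slc_of_real scaleR_conv_of_real)
  obtain h where h: "slice_regular \<Lambda> h" "\<forall>q\<in>\<Lambda>. F q = N q * h q"
  proof (rule slice_regular_divide[OF op F, where N = N and n = n and
        N' = "\<lambda>q. of_real 2 * q - of_real (2 * Re z0)" and n' = "\<lambda>z. of_real 2 * z - of_real (2 * Re z0)"])
    show "N (slc J z) = slc J (n z)" if "J \<in> imag_units" for J z
      using that by (rule N)
    show "of_real 2 * slc J z - of_real (2 * Re z0) = slc J (of_real 2 * z - of_real (2 * Re z0))"
      if "J \<in> imag_units" for J z
      by (simp only: slc_diff slc_mult[OF that] slc_of_real)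
    show "(n has_field_derivative of_real 2 * z - of_real (2 * Re z0)) (at z)" for z
      unfolding n_def by (auto intro!: derivative_eq_intros simp: complex_eq_iff)
    show "of_real 2 * z - of_real (2 * Re z0) \<noteq> 0" if "n z = 0" for z
    proof -
      from that have "z = z0 \<or> z = cnj z0"
        by (simp add: n_def)
      with y show ?thesis
        by (auto simp: complex_eq_iff)
    qed
    show "F q = 0" if q: "q \<in> \<Lambda>" "N q = 0" for q
    proof -
      obtain J z where J: "J \<in> imag_units" "0 \<le> Im z" "q = slc J z"
        using slc_surj[of q] .
      then have "n z = 0"
        using q(2) by (simp add: N slc_eq_0)
      then have "z = z0 \<or> z = cnj z0"
        by (simp add: n_def)
      then have z: "z = z0"
        using J(2) y by auto
      have m: "slc J z0 \<in> \<Lambda>"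
        using q J z by simp
      obtain b c where p: "sphere_pair \<Lambda> g J z0 b c"
        using sphere_pair_exists[OF \<Lambda> g' J(1) m] .
      have "b = - (I' * c)"
        using good[OF J(1) m sphere_pair_mono[OF p sub]] by (simp add: add_eq_0_iff2)
      moreover have "F (slc J z0) = (Im z0 *\<^sub>R I') * b - of_real (Im z0) * c
          + J * ((Im z0 *\<^sub>R I') * c + of_real (Im z0) * b)"
        using sphere_pair_value[OF Fpair[OF J(1) p] J(1)] unfolding p' .
      ultimately show ?thesis
        using imag_units_mult_self'[OF I', of c] by (simp add: J(3) z of_real_def)
    qed
  qed (rule that)
  define G where "G = regular_prod \<Lambda> (\<lambda>q. q - slc I' z0) h"
  have G: "slice_regular \<Lambda> G"
    unfolding G_def by (rule slice_regular_prod[OF \<Lambda> slice_regular_linear[OF op] h(1)])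
  have off: "g (slc J z) = G (slc J z)" if J: "J \<in> imag_units" "slc J z \<in> \<Lambda>" "n z \<noteq> 0" for J z
  proof -
    obtain b c where pg: "sphere_pair \<Lambda> g J z b c"
      using sphere_pair_exists[OF \<Lambda> g' J(1,2)] .
    obtain \<beta> \<gamma> where ph: "sphere_pair \<Lambda> h J z \<beta> \<gamma>"
      using sphere_pair_exists[OF \<Lambda> h(1) J(1,2)] .
    define A A' where "A = of_real (Re z) - slc I' z0" and "A' = of_real (Re z) - p'"
    define x where "x = Re z - Re z0"
    have A: "A = x *\<^sub>R 1 - Im z0 *\<^sub>R I'" and A': "A' = x *\<^sub>R 1 + Im z0 *\<^sub>R I'"
      by (simp_all add: A_def A'_def x_def p'_def slc_def of_real_def algebra_simps)
    have pG: "G (slc J z) = (A * \<beta> - of_real (Im z) * \<gamma>) + J * (A * \<gamma> + of_real (Im z) * \<beta>)"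
      unfolding G_def A_def by (rule regular_prod_eq[OF J(1) sphere_pair_linear[OF op J(2)] ph])
    have "sphere_pair \<Lambda> (\<lambda>q. N q * h q) J z (Re (n z) *\<^sub>R \<beta> - Im (n z) *\<^sub>R \<gamma>)
        (Re (n z) *\<^sub>R \<gamma> + Im (n z) *\<^sub>R \<beta>)"
      by (rule sphere_pair_slice_preserving_mult[OF ph N])
    then have "sphere_pair \<Lambda> F J z (Re (n z) *\<^sub>R \<beta> - Im (n z) *\<^sub>R \<gamma>) (Re (n z) *\<^sub>R \<gamma> + Im (n z) *\<^sub>R \<beta>)"
      by (rule sphere_pair_cong) (simp add: h(2))
    from sphere_pair_unique[OF this Fpair[OF J(1) pg] J(1)]
    have e1: "Re (n z) *\<^sub>R \<beta> - Im (n z) *\<^sub>R \<gamma> = A' * b - of_real (Im z) * c"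
      and e2: "Re (n z) *\<^sub>R \<gamma> + Im (n z) *\<^sub>R \<beta> = A' * c + of_real (Im z) * b"
      by (simp_all add: A'_def)
    have n1: "Re (n z) = x * x + Im z0 * Im z0 - Im z * Im z" and n2: "Im (n z) = 2 * x * Im z"
      by (simp_all add: n_def x_def algebra_simps)
    \<comment> \<open>Multiply by \<open>(A, Im z)\<close>, the coefficients of \<open>q - slc I' z0\<close>, the two expressions for the
      coefficients of \<open>F\<close>, as \<open>N h\<close> and as \<open>(q - p') * g\<close>; the result is \<open>N G = N g\<close>.\<close>
    have AA': "A * (A' * q) = (x * x + Im z0 * Im z0) *\<^sub>R q" for q
      using imag_units_mult_self'[OF I', of q]
      by (simp add: A A' distrib_left distrib_right left_diff_distrib right_diff_distrib algebra_simps)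
    have ApB: "A * q + A' * q = (2 * x) *\<^sub>R q" for q
      by (simp add: A A' distrib_right left_diff_distrib flip: scaleR_add_left)
    let ?P1 = "A * \<beta> - of_real (Im z) * \<gamma>" and ?P2 = "A * \<gamma> + of_real (Im z) * \<beta>"
    have "Re (n z) *\<^sub>R ?P1 - Im (n z) *\<^sub>R ?P2 =
        A * (Re (n z) *\<^sub>R \<beta> - Im (n z) *\<^sub>R \<gamma>) - Im z *\<^sub>R (Re (n z) *\<^sub>R \<gamma> + Im (n z) *\<^sub>R \<beta>)"
      by (simp add: of_real_def algebra_simps)
    also have "\<dots> = A * (A' * b) - Im z *\<^sub>R (A * c + A' * c) - (Im z * Im z) *\<^sub>R b"
      unfolding e1 e2 by (simp add: of_real_def algebra_simps)
    also have "\<dots> = Re (n z) *\<^sub>R b - Im (n z) *\<^sub>R c"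
      unfolding AA' ApB n1 n2 by (simp add: algebra_simps)
    finally have r1: "Re (n z) *\<^sub>R ?P1 - Im (n z) *\<^sub>R ?P2 = Re (n z) *\<^sub>R b - Im (n z) *\<^sub>R c" .
    have "Re (n z) *\<^sub>R ?P2 + Im (n z) *\<^sub>R ?P1 =
        A * (Re (n z) *\<^sub>R \<gamma> + Im (n z) *\<^sub>R \<beta>) + Im z *\<^sub>R (Re (n z) *\<^sub>R \<beta> - Im (n z) *\<^sub>R \<gamma>)"
      by (simp add: of_real_def algebra_simps)
    also have "\<dots> = A * (A' * c) + Im z *\<^sub>R (A * b + A' * b) - (Im z * Im z) *\<^sub>R c"
      unfolding e1 e2 by (simp add: of_real_def algebra_simps)
    also have "\<dots> = Re (n z) *\<^sub>R c + Im (n z) *\<^sub>R b"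
      unfolding AA' ApB n1 n2 by (simp add: algebra_simps)
    finally have r2: "Re (n z) *\<^sub>R ?P2 + Im (n z) *\<^sub>R ?P1 = Re (n z) *\<^sub>R c + Im (n z) *\<^sub>R b" .
    have "slc J (n z) * g (slc J z) = slc J (n z) * G (slc J z)"
      unfolding pG sphere_pair_value[OF pg J(1)] slc_mult_coeffs[OF J(1)] r1 r2 ..
    moreover have "slc J (n z) \<noteq> 0"
      using J by (simp add: slc_eq_0)
    ultimately show ?thesis
      by simp
  qed
  \<comment> \<open>On each slice both sides are continuous and agree off the zeros of \<open>n\<close>, hence everywhere.\<close>
  have "g q = G q" if q: "q \<in> \<Lambda>" for q
  proof -
    obtain J z where J: "J \<in> imag_units" "0 \<le> Im z" "q = slc J z"
      using slc_surj[of q] .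
    show ?thesis
    proof (rule quat_eqI_cmp[of J])
      fix u
      define D where "D = {w. slc J w \<in> \<Lambda>}"
      define d where "d w = cmp J u (g (slc J w)) - cmp J u (G (slc J w))" for w
      have D: "open D" "z \<in> D"
        unfolding D_def using open_vimage_slc[OF op] q J by auto
      have "d holomorphic_on D"
        unfolding d_def D_def
        by (rule holomorphic_on_diff[OF slice_regularD[OF op g' J(1)] slice_regularD[OF op G J(1)]])
      then have "isCont d z"
        using D by (intro field_differentiable_imp_continuous_at holomorphic_on_imp_differentiable_at)
      then have "(d \<longlongrightarrow> d z) (at z)"
        by (simp add: isCont_def)
      moreover have "\<forall>\<^sub>F w in at z. w \<in> D - ({z0, cnj z0} - {z}) - {z}"
        using D by (intro eventually_at_in_open open_Diff finite_imp_closed) auto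
      then have "\<forall>\<^sub>F w in at z. d w = 0"
      proof eventually_elim
        case (elim w)
        then have "n w \<noteq> 0" "slc J w \<in> \<Lambda>"
          by (auto simp: n_def D_def)
        then show ?case
          using off[OF J(1)] by (simp add: d_def)
      qed
      then have "(d \<longlongrightarrow> 0) (at z)"
        by (rule tendsto_eventually)
      ultimately have "d z = 0"
        by (intro tendsto_unique[of "at z" d]) auto
      then show "cmp J u (g q) = cmp J u (G q)"
        by (simp add: d_def J(3))
    qed
  qed
  then have "\<forall>q\<in>\<Lambda>. g q = regular_prod \<Lambda> (\<lambda>q. q - slc I' z0) h q"
    unfolding G_def by blast
  with \<Lambda> CL sub h(1) show ?thesis
    unfolding divides_near_def by blast
qed

text \<open>
  On a connected part \<open>C\<close> of the sphere through \<open>z0\<close>, where \<open>g = b + J c\<close>, the factor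
  \<open>q - slc I' z0\<close> divides \<open>g\<close> near \<open>C\<close> exactly if \<open>b + I' c\<close> vanishes. If \<open>C\<close> contained the point
  \<open>slc I' z0\<close>, this would say that \<open>g\<close> vanishes there.
\<close>

lemma divides_near_iff:
  assumes \<Omega>: "slice_domain \<Omega>" and g: "slice_regular \<Omega> g" and z0: "Im z0 \<ge> 0"
    and C: "connected C" "C \<subseteq> qsphere (Re z0) (Im z0) \<inter> \<Omega>"
    and I: "I \<in> imag_units" "slc I z0 \<in> C" and I': "I' \<in> imag_units"
    and p: "sphere_pair \<Omega> g I z0 b c"
  shows "divides_near \<Omega> (slc I' z0) g C \<longleftrightarrow> b + I' * c = 0"
proof
  assume "divides_near \<Omega> (slc I' z0) g C"
  then show "b + I' * c = 0"
    using I I' p by (rule divides_near_imp)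
next
  assume bc: "b + I' * c = 0"
  show "divides_near \<Omega> (slc I' z0) g C"
  proof (cases "Im z0 = 0")
    case True
    have eq: "slc J z0 = of_real (Re z0)" for J
      using True by (simp add: slc_def)
    have "g (of_real (Re z0)) = 0"
      using bc sphere_pair_real[OF p I(1) True] unfolding eq by simp
    then show ?thesis
      unfolding eq using C by (intro divides_near_real[OF \<Omega> g]) auto
  next
    case False
    with z0 have y: "Im z0 > 0" by simp
    obtain b' c' where p': "\<forall>J\<in>imag_units. slc J z0 \<in> C \<longrightarrow> sphere_pair \<Omega> g J z0 b' c'"
      using sphere_pair_constant[OF \<Omega> g z0 C] .
    then have "sphere_pair \<Omega> g I z0 b' c'"
      using I by blast
    from sphere_pair_unique[OF this p I(1)] bc have "b' + I' * c' = 0"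
      by simp
    then show ?thesis
      by (rule divides_near_sphere[OF \<Omega> g I' y C(2) p'])
  qed
qed

section \<open>Zeros of the regular product and of the symmetrization\<close>

lemma slc_conjugate:
  assumes "q \<noteq> 0"
  shows "inverse q * slc I z * q = slc (inverse q * I * q) z"
proof -
  have "inverse q * (r *\<^sub>R 1) * q = r *\<^sub>R 1" for r
    using left_inverse[OF assms] by simp
  then show ?thesis
    by (simp add: slc_def of_real_def distrib_left distrib_right)
qed

lemma regular_prod_eq_value:
  assumes I: "I \<in> imag_units" and f: "sphere_pair \<Omega> f I z b' c'" and g: "sphere_pair \<Omega> g I z b c"
  shows "regular_prod \<Omega> f g (slc I z) = f (slc I z) * b + I * (f (slc I z) * c)"
  unfolding regular_prod_eq[OF I f g] sphere_pair_value[OF f I]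
  using imag_units_mult_self'[OF I, of "c' * c"]
  by (simp add: distrib_left distrib_right mult.assoc)

text \<open>
  Where \<open>f\<close> does not vanish, the product vanishes at \<open>x + y I\<close> exactly if \<open>b + I' c\<close> does, where \<open>I'\<close> is
  the conjugate of \<open>I\<close> by the value of \<open>f\<close> and \<open>(b, c)\<close> are the coefficients of \<open>g\<close>.
\<close>

lemma regular_prod_eq_0_iff:
  assumes I: "I \<in> imag_units" and f: "sphere_pair \<Omega> f I z b' c'" and g: "sphere_pair \<Omega> g I z b c"
    and nz: "f (slc I z) \<noteq> 0"
  shows "regular_prod \<Omega> f g (slc I z) = 0 \<longleftrightarrow>
    b + (inverse (f (slc I z)) * I * f (slc I z)) * c = 0"
proof -
  let ?q = "f (slc I z)"
  have "regular_prod \<Omega> f g (slc I z) = ?q * b + I * (?q * c)"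
    by (rule regular_prod_eq_value[OF I f g])
  also have "I * (?q * c) = ?q * (inverse ?q * (I * (?q * c)))"
    by (rule mult_inverse_cancel[OF nz, symmetric])
  also have "inverse ?q * (I * (?q * c)) = (inverse ?q * I * ?q) * c"
    by (simp only: mult.assoc)
  also have "?q * b + ?q * ((inverse ?q * I * ?q) * c) = ?q * (b + (inverse ?q * I * ?q) * c)"
    by (simp only: distrib_left)
  finally show ?thesis
    using nz by (simp only: mult_eq_0_iff simp_thms)
qed

lemma exists_unit_zero_iff:
  "(\<exists>I\<in>imag_units. b + I * c = 0) \<longleftrightarrow> norm b = norm c \<and> inner b c = 0"
proof
  assume "\<exists>I\<in>imag_units. b + I * c = 0"
  then obtain I where I: "I \<in> imag_units" "b = - (I * c)"
    by (auto simp: add_eq_0_iff2)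
  have "norm I = 1"
    using I(1) by (simp add: imag_units_iff)
  moreover have "inner (I * c) c = 0"
    using inner_unit_mult[OF I(1), of c c] by (simp add: inner_commute)
  ultimately show "norm b = norm c \<and> inner b c = 0"
    by (simp add: I(2) norm_mult)
next
  assume bc: "norm b = norm c \<and> inner b c = 0"
  show "\<exists>I\<in>imag_units. b + I * c = 0"
  proof (cases "c = 0")
    case True
    obtain I where "I \<in> imag_units"
      by (rule imag_units_nonempty)
    with True bc show ?thesis
      by (intro bexI[of _ I]) auto
  next
    case False
    define I where "I = - (b * inverse c)"
    have "qRe (b * inverse c) = inner b c / (norm c)\<^sup>2"
      by (simp add: inverse_quat_def inner_quat_def divide_inverse algebra_simps)
    then have "qRe I = 0"
      using bc by (simp add: I_def)
    moreover have "norm I = 1"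
      using bc False by (simp add: I_def norm_mult norm_inverse)
    ultimately have "I \<in> imag_units"
      by (simp add: imag_units_iff)
    moreover have "I * c = - (b * (inverse c * c))"
      by (simp only: I_def mult_minus_left mult.assoc)
    then have "b + I * c = 0"
      unfolding left_inverse[OF False] by simp
    ultimately show ?thesis
      by blast
  qed
qed

lemma symmetrization_eq_0_iff:
  assumes "I \<in> imag_units" "sphere_pair \<Omega> f I z b c"
  shows "symmetrization \<Omega> f (slc I z) = 0 \<longleftrightarrow> norm b = norm c \<and> inner b c = 0"
  unfolding symmetrization_eq[OF assms] slc_eq_0[OF assms(1)]
  by (simp add: complex_eq_iff)

lemma zero_set_regular_prod:
  assumes \<Omega>: "slice_domain \<Omega>" and f: "slice_regular \<Omega> f" and g: "slice_regular \<Omega> g"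
    and p: "p \<in> \<Omega>" "f p \<noteq> 0"
  shows "regular_prod \<Omega> f g p = 0 \<longleftrightarrow> divides_near_point \<Omega> (inverse (f p) * p * f p) g p"
proof -
  obtain I z where I: "I \<in> imag_units" "0 \<le> Im z" "p = slc I z"
    using slc_surj[of p] .
  have m: "slc I z \<in> \<Omega>" and nz: "f (slc I z) \<noteq> 0"
    using p I(3) by simp_all
  obtain b' c' where pf: "sphere_pair \<Omega> f I z b' c'"
    using sphere_pair_exists[OF \<Omega> f I(1) m] .
  obtain b c where pg: "sphere_pair \<Omega> g I z b c"
    using sphere_pair_exists[OF \<Omega> g I(1) m] .
  have sph: "qsphere (qRe p) (norm (qIm p)) = qsphere (Re z) (Im z)"
    using I by (simp add: slc_sel norm_qIm_slc)
  define C where "C = connected_component_set (qsphere (Re z) (Im z) \<inter> \<Omega>) p"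
  have "p \<in> qsphere (Re z) (Im z) \<inter> \<Omega>"
    using I m by (auto simp: qsphere_eq)
  then have C: "connected C" "C \<subseteq> qsphere (Re z) (Im z) \<inter> \<Omega>" "slc I z \<in> C"
    unfolding C_def I(3)[symmetric]
    using connected_component_subset[of "qsphere (Re z) (Im z) \<inter> \<Omega>" p]
    by (simp_all add: connected_component_refl_eq)
  have "divides_near \<Omega> (slc (inverse (f (slc I z)) * I * f (slc I z)) z) g C \<longleftrightarrow>
      b + (inverse (f (slc I z)) * I * f (slc I z)) * c = 0"
    by (rule divides_near_iff[OF \<Omega> g I(2) C(1,2) I(1) C(3) imag_units_conjugate[OF I(1) nz] pg])
  then show ?thesis
    unfolding divides_near_point_def sph C_def[symmetric]
    unfolding I(3) slc_conjugate[OF nz] regular_prod_eq_0_iff[OF I(1) pf pg nz]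
    by (rule sym)
qed

lemma divides_near_some_iff:
  assumes \<Omega>: "slice_domain \<Omega>" and f: "slice_regular \<Omega> f" and z0: "Im z0 \<ge> 0"
    and C: "connected C" "C \<subseteq> qsphere (Re z0) (Im z0) \<inter> \<Omega>"
    and I: "I \<in> imag_units" "slc I z0 \<in> C" and p: "sphere_pair \<Omega> f I z0 b c"
  shows "(\<exists>p'\<in>qsphere (Re z0) (Im z0). divides_near \<Omega> p' f C) \<longleftrightarrow> norm b = norm c \<and> inner b c = 0"
proof -
  have "(\<exists>p'\<in>qsphere (Re z0) (Im z0). divides_near \<Omega> p' f C) \<longleftrightarrow>
      (\<exists>I'\<in>imag_units. divides_near \<Omega> (slc I' z0) f C)"
    unfolding qsphere_eq by blast
  also have "\<dots> \<longleftrightarrow> (\<exists>I'\<in>imag_units. b + I' * c = 0)"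
    by (intro bex_cong refl divides_near_iff[OF \<Omega> f z0 C I _ p])
  finally show ?thesis
    unfolding exists_unit_zero_iff .
qed

theorem proposition8p4:
  fixes \<Omega> C :: "quat set" and f g :: "quat \<Rightarrow> quat" and x y :: real
  assumes "slice_domain \<Omega>"
    and "slice_regular \<Omega> f"
    and "slice_regular \<Omega> g"
    and "qsphere x y \<inter> \<Omega> \<noteq> {}"
    and "C \<in> components (qsphere x y \<inter> \<Omega>)"
  shows
    "zero_set \<Omega> (regular_prod \<Omega> f g) =
       zero_set \<Omega> f \<union>
       {p \<in> \<Omega> - zero_set \<Omega> f. divides_near_point \<Omega> (inverse (f p) * p * f p) g p}
     \<and>
     (zero_set \<Omega> (symmetrization \<Omega> f) \<inter> C \<noteq> {} \<longleftrightarrow> C \<subseteq> zero_set \<Omega> (symmetrization \<Omega> f)) \<and>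
     (C \<subseteq> zero_set \<Omega> (symmetrization \<Omega> f) \<longleftrightarrow> (\<exists>p'\<in>qsphere x y. divides_near \<Omega> p' f C))
     \<and>
     ((\<exists>p'\<in>qsphere x y. divides_near \<Omega> p' f C) \<longleftrightarrow>
      (\<exists>p''\<in>qsphere x y. divides_near \<Omega> p'' (regular_conj \<Omega> f) C))"
proof -
  note \<Omega> = assms(1) and f = assms(2) and g = assms(3)
  have prod0: "regular_prod \<Omega> f g p = 0" if p: "p \<in> \<Omega>" "f p = 0" for p
  proof -
    obtain I z where I: "I \<in> imag_units" "0 \<le> Im z" "p = slc I z"
      using slc_surj[of p] .
    have m: "slc I z \<in> \<Omega>"
      using p I(3) by simp
    obtain b' c' where pf: "sphere_pair \<Omega> f I z b' c'"
      using sphere_pair_exists[OF \<Omega> f I(1) m] .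
    obtain b c where pg: "sphere_pair \<Omega> g I z b c"
      using sphere_pair_exists[OF \<Omega> g I(1) m] .
    show ?thesis
      using regular_prod_eq_value[OF I(1) pf pg] p(2) by (simp add: I(3))
  qed
  have part1: "zero_set \<Omega> (regular_prod \<Omega> f g) = zero_set \<Omega> f \<union>
       {p \<in> \<Omega> - zero_set \<Omega> f. divides_near_point \<Omega> (inverse (f p) * p * f p) g p}"
    using prod0 zero_set_regular_prod[OF \<Omega> f g] unfolding zero_set_def by blast
  define z0 where "z0 = Complex x \<bar>y\<bar>"
  have z0: "0 \<le> Im z0"
    by (simp add: z0_def)
  have S: "qsphere x y = qsphere (Re z0) (Im z0)"
    by (simp add: z0_def qsphere_abs)
  have C: "connected C" "C \<subseteq> qsphere (Re z0) (Im z0) \<inter> \<Omega>" "C \<noteq> {}"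
    using assms(5) in_components_connected in_components_subset in_components_nonempty
    unfolding S by blast+
  obtain b c where bc: "\<forall>J\<in>imag_units. slc J z0 \<in> C \<longrightarrow> sphere_pair \<Omega> f J z0 b c"
    using sphere_pair_constant[OF \<Omega> f z0 C(1,2)] .
  have sym: "q \<in> zero_set \<Omega> (symmetrization \<Omega> f) \<longleftrightarrow> norm b = norm c \<and> inner b c = 0"
    if q: "q \<in> C" for q
  proof -
    obtain J where J: "J \<in> imag_units" "q = slc J z0"
      using q C(2) by (auto simp: qsphere_eq)
    have "sphere_pair \<Omega> f J z0 b c"
      using bc J q by blast
    from symmetrization_eq_0_iff[OF J(1) this] show ?thesis
      using q C(2) by (auto simp: zero_set_def J(2))
  qed
  obtain I where I: "I \<in> imag_units" "slc I z0 \<in> C"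
    using C(2,3) unfolding qsphere_eq by blast
  then have p: "sphere_pair \<Omega> f I z0 b c"
    using bc by blast
  have div: "(\<exists>p'\<in>qsphere x y. divides_near \<Omega> p' f C) \<longleftrightarrow> norm b = norm c \<and> inner b c = 0"
    unfolding S by (rule divides_near_some_iff[OF \<Omega> f z0 C(1,2) I p])
  have "(\<exists>p'\<in>qsphere x y. divides_near \<Omega> p' (regular_conj \<Omega> f) C) \<longleftrightarrow>
      norm (qcnj b) = norm (qcnj c) \<and> inner (qcnj b) (qcnj c) = 0"
    unfolding S
    by (rule divides_near_some_iff[OF \<Omega> slice_regular_conj[OF \<Omega> f] z0 C(1,2) I sphere_pair_conj[OF I(1) p]])
  also have "\<dots> \<longleftrightarrow> norm b = norm c \<and> inner b c = 0"
    by (simp add: norm_quat_def inner_quat_def)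
  finally have div_conj: "(\<exists>p'\<in>qsphere x y. divides_near \<Omega> p' (regular_conj \<Omega> f) C) \<longleftrightarrow>
      norm b = norm c \<and> inner b c = 0" .
  show ?thesis
    unfolding div div_conj using part1 sym C(3) by blast
qed

end
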